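(* Let $\gamma\in\mathbb{R}\setminus\{0\}$. Then there exist $\lambda>0$ and $\varepsilon_0>0$ such that for any $0<\varepsilon\le\varepsilon_0$ there exist analytic, non-zonal and non-trivial steady solutions $\Psi_\varepsilon$ to the $\gamma$-rotating Euler equations on $\mathbb{S}^2$ such that $$\|\gamma Y_1^0-\Psi_\varepsilon\|_{\mathcal{G}_\lambda(\mathbb{S}^2)}=O(\varepsilon).$$
   Context: $\mathbb{S}^2$ is the unit sphere with colatitude $\theta$ and longitude $\varphi$, coordinates $(\sin\theta\cos\varphi,\sin\theta\sin\varphi,\cos\theta)$; $\mathbf{e}_\theta=\partial_\theta$, $\mathbf{e}_\varphi=\frac{1}{\sin\theta}\partial_\varphi$; $\nabla f=\partial_\theta f\,\mathbf{e}_\theta+\frac1{\sin\theta}\partial_\varphi f\,\mathbf{e}_\varphi$, $\nabla^\perp f=J\nabla f$ with $J\mathbf{e}_\theta=-\mathbf{e}_\varphi$, $J\mathbf{e}_\varphi=\mathbf{e}_\theta$; $\Delta$ is the Laplace-Beltrami operator. The $\gamma$-rotating Euler equations are $\partial_t\Omega+U\cdot\nabla(\Omega-4\gamma Y_1^0)=0$, $U=\nabla^\perp\Psi$, $\Delta\Psi=\Omega$, with $Y_1^0=\frac12\sqrt{\frac3\pi}\cos\theta$. A steady solution is a time-independent stream function $\Psi$ with $\nabla^\perp\Psi\cdot\nabla(\Delta\Psi-4\gamma Y_1^0)=0$. Let $\{Y_n^m:n\ge0,|m|\le n\}$ be the $L^2(\mathbb{S}^2)$-orthonormal basis of real spherical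 harmonics, $-\Delta Y_n^m=\lambda_nY_n^m$, $\lambda_n=n(n+1)$, $\mu_n=\lambda_n+1$. For $u=\sum u_n^mY_n^m$, the Gevrey norm is $\|u\|_{\mathcal{G}_\lambda}^2=\sum_{n\ge0}\sum_{|m|\le n}\mu_n^2e^{2\lambda\mu_n^{1/2}}|u_n^m|^2$. The $O(\varepsilon)$ is as $\varepsilon\to0$ with constant independent of $\varepsilon$. A function is zonal if it depends only on $\theta$. Non-trivial means not the sum of a zonal function and an element of $\mathbf{Y}_2=\mathrm{span}\{Y_2^m:|m|\le2\}$ (such sums form the kernel of the linearized Euler operator). *)

theory Defs
  imports
    "HOL-Analysis.Analysis"
    "HOL-Computational_Algebra.Polynomial"
    "HOL-Library.Landau_Symbols"
begin

text \<open>Functions on the sphere are functions on \<^typ>\<open>real^3\<close> of which only the values on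
  \<^term>\<open>sphere (0::real^3) 1\<close> matter. The differential operators act on functions of colatitude
  and longitude and are meaningful for colatitudes strictly between 0 and \<^term>\<open>pi\<close>.\<close>

definition sph_pt :: "real \<Rightarrow> real \<Rightarrow> real^3" where
  "sph_pt \<theta> \<phi> = vector [sin \<theta> * cos \<phi>, sin \<theta> * sin \<phi>, cos \<theta>]"

definition in_coords :: "(real^3 \<Rightarrow> real) \<Rightarrow> real \<Rightarrow> real \<Rightarrow> real" where
  "in_coords f \<theta> \<phi> = f (sph_pt \<theta> \<phi>)"

subsection \<open>Differential operators on the sphere\<close>

definition d_theta :: "(real \<Rightarrow> real \<Rightarrow> real) \<Rightarrow> real \<Rightarrow> real \<Rightarrow> real" where
  "d_theta f \<theta> \<phi> = deriv (\<lambda>t. f t \<phi>) \<theta>"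

definition d_phi :: "(real \<Rightarrow> real \<Rightarrow> real) \<Rightarrow> real \<Rightarrow> real \<Rightarrow> real" where
  "d_phi f \<theta> \<phi> = deriv (\<lambda>p. f \<theta> p) \<phi>"

definition e_theta :: "real \<Rightarrow> real \<Rightarrow> real^3" where
  "e_theta \<theta> \<phi> = vector [cos \<theta> * cos \<phi>, cos \<theta> * sin \<phi>, - sin \<theta>]"

definition e_phi :: "real \<Rightarrow> real \<Rightarrow> real^3" where
  "e_phi \<theta> \<phi> = vector [- sin \<phi>, cos \<phi>, 0]"

definition sgrad :: "(real \<Rightarrow> real \<Rightarrow> real) \<Rightarrow> real \<Rightarrow> real \<Rightarrow> real^3" where
  "sgrad f \<theta> \<phi> = d_theta f \<theta> \<phi> *\<^sub>R e_theta \<theta> \<phi> + (1 / sin \<theta> * d_phi f \<theta> \<phi>) *\<^sub>R e_phi \<theta> \<phi>"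

text \<open>The linear map on the tangent plane sending \<^const>\<open>e_theta\<close> to minus \<^const>\<open>e_phi\<close> and
  \<^const>\<open>e_phi\<close> to \<^const>\<open>e_theta\<close>.\<close>

definition rotJ :: "real \<Rightarrow> real \<Rightarrow> real^3 \<Rightarrow> real^3" where
  "rotJ \<theta> \<phi> v = (v \<bullet> e_phi \<theta> \<phi>) *\<^sub>R e_theta \<theta> \<phi> - (v \<bullet> e_theta \<theta> \<phi>) *\<^sub>R e_phi \<theta> \<phi>"

definition sgrad_perp :: "(real \<Rightarrow> real \<Rightarrow> real) \<Rightarrow> real \<Rightarrow> real \<Rightarrow> real^3" where
  "sgrad_perp f \<theta> \<phi> = rotJ \<theta> \<phi> (sgrad f \<theta> \<phi>)"

definition laplace_beltrami :: "(real \<Rightarrow> real \<Rightarrow> real) \<Rightarrow> real \<Rightarrow> real \<Rightarrow> real" where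
  "laplace_beltrami f \<theta> \<phi> =
     1 / sin \<theta> * d_theta (\<lambda>t p. sin t * d_theta f t p) \<theta> \<phi> +
     1 / (sin \<theta>)\<^sup>2 * d_phi (d_phi f) \<theta> \<phi>"

lemma rotJ_frame:
  "rotJ \<theta> \<phi> (e_theta \<theta> \<phi>) = - e_phi \<theta> \<phi>" "rotJ \<theta> \<phi> (e_phi \<theta> \<phi>) = e_theta \<theta> \<phi>"
proof -
  have tt: "e_theta \<theta> \<phi> \<bullet> e_theta \<theta> \<phi> = 1"
  proof -
    have "e_theta \<theta> \<phi> \<bullet> e_theta \<theta> \<phi> = (cos \<theta>)\<^sup>2 * ((cos \<phi>)\<^sup>2 + (sin \<phi>)\<^sup>2) + (sin \<theta>)\<^sup>2"
      unfolding distrib_left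
      by (simp add: e_theta_def inner_vec_def sum_3 power2_eq_square algebra_simps
        del: sin_cos_squared_add sin_cos_squared_add2 sin_cos_squared_add3)
    also have "\<dots> = 1"
      by simp
    finally show ?thesis .
  qed
  have pp: "e_phi \<theta> \<phi> \<bullet> e_phi \<theta> \<phi> = 1"
    by (simp add: e_phi_def inner_vec_def sum_3 flip: power2_eq_square)
  have tp: "e_theta \<theta> \<phi> \<bullet> e_phi \<theta> \<phi> = 0"
    by (simp add: e_theta_def e_phi_def inner_vec_def sum_3)
  show "rotJ \<theta> \<phi> (e_theta \<theta> \<phi>) = - e_phi \<theta> \<phi>" "rotJ \<theta> \<phi> (e_phi \<theta> \<phi>) = e_theta \<theta> \<phi>"
    using tt pp tp by (simp_all add: rotJ_def inner_commute)
qed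

subsection \<open>Real spherical harmonics\<close>

definition legendre_poly :: "nat \<Rightarrow> real poly" where
  "legendre_poly n = smult (1 / (2 ^ n * fact n)) ((pderiv ^^ n) ([:-1, 0, 1:] ^ n))"

definition assoc_legendre :: "nat \<Rightarrow> nat \<Rightarrow> real \<Rightarrow> real" where
  "assoc_legendre n k t = sqrt (1 - t\<^sup>2) ^ k * poly ((pderiv ^^ k) (legendre_poly n)) t"

definition sph_harm_const :: "nat \<Rightarrow> nat \<Rightarrow> real" where
  "sph_harm_const n k = sqrt ((2 * real n + 1) / (4 * pi) * (fact (n - k) / fact (n + k)))"

text \<open>On the sphere the \<open>k\<close>-th power of the sine of the colatitude times the cosine (sine) of
  \<open>k\<close> times the longitude is the real (imaginary) part of the \<open>k\<close>-th power of
  \<open>x$1 + \<i> x$2\<close>. Writing the angular factor this way makes the definition valid at the poles;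
  \<open>sph_harm_sph_pt\<close> below is the usual formula. The Condon-Shortley sign is omitted.\<close>

definition sph_harm :: "nat \<Rightarrow> int \<Rightarrow> real^3 \<Rightarrow> real" where
  "sph_harm n m x =
     (let k = nat \<bar>m\<bar>; w = Complex (x$1) (x$2) ^ k
      in sph_harm_const n k * poly ((pderiv ^^ k) (legendre_poly n)) (x$3) *
         (if m = 0 then 1 else if m > 0 then sqrt 2 * Re w else sqrt 2 * Im w))"

lemma sph_harm_sph_pt:
  assumes "0 \<le> \<theta>" "\<theta> \<le> pi"
  shows "sph_harm n m (sph_pt \<theta> \<phi>) =
    sph_harm_const n (nat \<bar>m\<bar>) * assoc_legendre n (nat \<bar>m\<bar>) (cos \<theta>) *
    (if m = 0 then 1 else if m > 0 then sqrt 2 * cos (real_of_int \<bar>m\<bar> * \<phi>)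
     else sqrt 2 * sin (real_of_int \<bar>m\<bar> * \<phi>))"
proof -
  have s: "sqrt (1 - (cos \<theta>)\<^sup>2) = sin \<theta>"
    using sin_ge_zero[OF assms] by (simp add: sin_squared_eq[symmetric])
  have "Complex (sin \<theta> * cos \<phi>) (sin \<theta> * sin \<phi>) = of_real (sin \<theta>) * cis \<phi>"
    by (simp add: complex_eq_iff)
  then have w: "Complex (sin \<theta> * cos \<phi>) (sin \<theta> * sin \<phi>) ^ k =
      of_real (sin \<theta> ^ k) * cis (real k * \<phi>)" for k
    by (simp add: power_mult_distrib Complex.DeMoivre)
  have k: "real (nat \<bar>m\<bar>) = real_of_int \<bar>m\<bar>" by simp
  show ?thesis
    unfolding sph_harm_def Let_def assoc_legendre_def s sph_pt_def
    by (simp add: w k del: of_real_power)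
qed

lemma sph_harm_1_0: "sph_harm 1 0 (sph_pt \<theta> \<phi>) = 1/2 * sqrt (3 / pi) * cos \<theta>"
proof -
  have "sqrt (3 / (4 * pi)) = sqrt (3 / pi) / 2"
    using real_sqrt_divide[of "3 / pi" 4] by (simp add: field_simps)
  then show ?thesis
    by (simp add: sph_harm_def sph_harm_const_def legendre_poly_def sph_pt_def pderiv_pCons)
qed

subsection \<open>Steady solutions of the rotating Euler equations\<close>

text \<open>Both factors extend continuously to the poles when \<open>\<Psi>\<close> is smooth on the whole sphere,
  so nothing is lost by imposing the equation off the poles. The derivatives are only
  meaningful for smooth \<open>\<Psi>\<close>.\<close>

definition steady_euler :: "real \<Rightarrow> (real^3 \<Rightarrow> real) \<Rightarrow> bool" where
  "steady_euler \<gamma> \<Psi> \<longleftrightarrow>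
     (\<forall>\<theta> \<phi>. 0 < \<theta> \<and> \<theta> < pi \<longrightarrow>
        sgrad_perp (in_coords \<Psi>) \<theta> \<phi> \<bullet>
        sgrad (\<lambda>t p. laplace_beltrami (in_coords \<Psi>) t p - 4 * \<gamma> * in_coords (sph_harm 1 0) t p)
          \<theta> \<phi> = 0)"

subsection \<open>Analytic, zonal and trivial functions\<close>

definition real_analytic_on :: "(real^'n \<Rightarrow> real) \<Rightarrow> (real^'n) set \<Rightarrow> bool" where
  "real_analytic_on F U \<longleftrightarrow>
     (\<forall>p\<in>U. \<exists>r>0. \<exists>a :: ('n \<Rightarrow> nat) \<Rightarrow> real. \<forall>x\<in>ball p r.
        ((\<lambda>\<alpha>. a \<alpha> * (\<Prod>i\<in>UNIV. (x$i - p$i) ^ \<alpha> i)) has_sum F x) UNIV)"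

definition analytic_on_sphere :: "(real^3 \<Rightarrow> real) \<Rightarrow> bool" where
  "analytic_on_sphere f \<longleftrightarrow>
     (\<exists>U F. open U \<and> sphere 0 1 \<subseteq> U \<and> real_analytic_on F U \<and> (\<forall>x\<in>sphere 0 1. f x = F x))"

definition zonal :: "(real^3 \<Rightarrow> real) \<Rightarrow> bool" where
  "zonal f \<longleftrightarrow> (\<exists>g. \<forall>\<theta> \<phi>. 0 \<le> \<theta> \<and> \<theta> \<le> pi \<longrightarrow> f (sph_pt \<theta> \<phi>) = g \<theta>)"

definition in_Y2 :: "(real^3 \<Rightarrow> real) \<Rightarrow> bool" where
  "in_Y2 f \<longleftrightarrow> (\<exists>c :: int \<Rightarrow> real. \<forall>x\<in>sphere 0 1. f x = (\<Sum>m=-2..2. c m * sph_harm 2 m x))"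

definition nontrivial :: "(real^3 \<Rightarrow> real) \<Rightarrow> bool" where
  "nontrivial f \<longleftrightarrow> \<not> (\<exists>g h. zonal g \<and> in_Y2 h \<and> (\<forall>x\<in>sphere 0 1. f x = g x + h x))"

subsection \<open>Gevrey norms\<close>

text \<open>The integral is over the sphere with its surface measure, in coordinates.\<close>

definition sph_coeff :: "(real^3 \<Rightarrow> real) \<Rightarrow> nat \<Rightarrow> int \<Rightarrow> real" where
  "sph_coeff u n m =
     integral ({0..pi} \<times> {0..2 * pi})
       (\<lambda>(\<theta>, \<phi>). u (sph_pt \<theta> \<phi>) * sph_harm n m (sph_pt \<theta> \<phi>) * sin \<theta>)"

definition eigval :: "nat \<Rightarrow> real" where
  "eigval n = real n * (real n + 1)"

definition mu :: "nat \<Rightarrow> real" where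
  "mu n = eigval n + 1"

definition gevrey_term :: "real \<Rightarrow> (real^3 \<Rightarrow> real) \<Rightarrow> nat \<Rightarrow> real" where
  "gevrey_term l u n =
     (\<Sum>m=-int n..int n. (mu n)\<^sup>2 * exp (2 * l * sqrt (mu n)) * (sph_coeff u n m)\<^sup>2)"

definition gevrey_norm :: "real \<Rightarrow> (real^3 \<Rightarrow> real) \<Rightarrow> real" where
  "gevrey_norm l u = sqrt (\<Sum>n. gevrey_term l u n)"

text \<open>\<^const>\<open>gevrey_norm\<close> is real-valued, so finiteness of the norm has to be stated separately.\<close>

definition gevrey_finite :: "real \<Rightarrow> (real^3 \<Rightarrow> real) \<Rightarrow> bool" where
  "gevrey_finite l u \<longleftrightarrow> summable (gevrey_term l u)"

end

theory Submission
  imports Defs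
begin

text \<open>
  Write \<open>\<Psi> = \<kappa> u\<close> with \<open>\<gamma> Y\<^sub>1\<^sup>0 = \<kappa> z\<close>. It suffices to solve
  \<open>\<Delta>u - 4z = (\<nu> - 6) u + \<epsilon> u\<^sup>3\<close> on the sphere, because then the absolute vorticity is a function
  of the stream function. The base flow \<open>u = z\<close> solves this for \<open>\<nu> = \<epsilon> = 0\<close>, and the kernel of
  \<open>\<Delta> + 6\<close> is \<open>Y\<^sub>2\<close>. Among functions that are odd in \<open>z\<close> and even in \<open>y\<close>, which the cubic
  nonlinearity preserves, the kernel is spanned by \<open>xz\<close> alone, so one free parameter \<open>\<nu>\<close>
  takes care of the solvability condition. As \<open>y\<^sup>2 = 1 - x\<^sup>2 - z\<^sup>2\<close>, such a function is a
  function of \<open>x\<close> and \<open>z\<close>; put \<open>u = \<Sum> c\<^sub>i\<^sub>j (\<epsilon>x)\<^sup>i z\<^sup>j\<close> with \<open>c\<^sub>1\<^sub>1 = 1\<close>. The Laplacian multiplies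
  a monomial of degree \<open>d\<close> by \<open>-d(d + 1)\<close> up to terms of degree \<open>d - 2\<close>, which are a small
  perturbation when the coefficients decay like \<open>64\<^sup>-\<^sup>d\<close>; hence the coefficients are the fixed
  point of a contraction.

  If \<open>u\<close> were zonal plus an element of \<open>Y\<^sub>2\<close>, then all \<open>c\<^sub>1\<^sub>j\<close> with \<open>j \<ge> 3\<close> would vanish, and the
  equation at index \<open>(1, 3)\<close> would read \<open>6\<epsilon>c\<^sub>3\<^sub>3 = 3c\<^sub>0\<^sub>1\<^sup>2\<close>, which is absurd for small \<open>\<epsilon>\<close>.
  Since \<open>Y\<^sub>n\<^sup>m\<close> is orthogonal to polynomials of degree less than \<open>n\<close> and bounded by \<open>8\<^sup>n\<close>, the
  decay of the coefficients yields the Gevrey bound.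
\<close>

subsection \<open>Weighted coefficient arrays\<close>

definition conv :: "(nat \<Rightarrow> nat \<Rightarrow> real) \<Rightarrow> (nat \<Rightarrow> nat \<Rightarrow> real) \<Rightarrow> nat \<Rightarrow> nat \<Rightarrow> real" where
  "conv c d i j = (\<Sum>k\<le>i. \<Sum>l\<le>j. c k l * d (i - k) (j - l))"

text \<open>The factors \<open>1 / (i + 1)\<^sup>2\<close> make the weight stable under convolution.\<close>

definition wt :: "nat \<Rightarrow> nat \<Rightarrow> real" where
  "wt i j = (1 / (real i + 1)\<^sup>2) * (1 / (real j + 1)\<^sup>2) / 64 ^ (i + j)"

definition majorized :: "real \<Rightarrow> (nat \<Rightarrow> nat \<Rightarrow> real) \<Rightarrow> bool" where
  "majorized M c \<longleftrightarrow> (\<forall>i j. \<bar>c i j\<bar> \<le> M * wt i j)"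

lemma majorizedD: "majorized M c \<Longrightarrow> \<bar>c i j\<bar> \<le> M * wt i j"
  by (simp add: majorized_def)

lemma wt_pos [simp]: "0 < wt i j"
  by (simp add: wt_def)

lemma wt_nonneg [simp]: "0 \<le> wt i j"
  using wt_pos[of i j] by linarith

lemma wt_le: "wt i j \<le> 1 / 64 ^ (i + j)"
proof -
  have "wt i j \<le> 1 * 1 / 64 ^ (i + j)"
    unfolding wt_def by (intro divide_right_mono mult_mono) (auto simp: divide_simps)
  then show ?thesis by simp
qed

lemma majorized_nonneg: "majorized M c \<Longrightarrow> 0 \<le> M"
  using majorizedD[of M c 0 0] wt_pos[of 0 0]
  by (smt (verit) mult_nonneg_nonneg mult_neg_pos)

lemma majorized_mono: "majorized M c \<Longrightarrow> M \<le> N \<Longrightarrow> majorized N c"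
  unfolding majorized_def by (meson mult_right_mono order_trans wt_nonneg)

lemma majorized_add:
  "majorized M c \<Longrightarrow> majorized N d \<Longrightarrow> majorized (M + N) (\<lambda>i j. c i j + d i j)"
  unfolding majorized_def distrib_right by (meson abs_triangle_ineq add_mono order_trans)

lemma sum_inverse_squares_le: "(\<Sum>k\<le>n. 1 / (real k + 1)\<^sup>2) \<le> 2 - 1 / (real n + 1)"
proof (induction n)
  case (Suc n)
  have "1 / (real n + 2)\<^sup>2 \<le> 1 / ((real n + 1) * (real n + 2))"
    by (rule divide_left_mono) (auto simp: power2_eq_square)
  also have "\<dots> = 1 / (real n + 1) - 1 / (real n + 2)"
    by (simp add: field_simps)
  finally show ?case using Suc by (simp add: add_ac)
qed simp

text \<open>With \<open>p = k + 1\<close> and \<open>q = i - k + 1\<close>, the bound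
  \<open>(i + 1)^2 <= (p + q)^2 <= 2 (p^2 + q^2)\<close> trades a product of inverse squares for
  \<open>1 / (i + 1)^2\<close> times their sum. Both resulting sums are at most 2, whence the
  constant \<open>2 (2 + 2) = 8\<close>.\<close>

lemma sum_inverse_squares_conv_le:
  "(\<Sum>k\<le>i. (1 / (real k + 1)\<^sup>2) * (1 / (real (i - k) + 1)\<^sup>2)) \<le> 8 * (1 / (real i + 1)\<^sup>2)"
proof -
  have *: "(1 / (real k + 1)\<^sup>2) * (1 / (real (i - k) + 1)\<^sup>2)
      \<le> 2 * (1 / (real i + 1)\<^sup>2) * (1 / (real k + 1)\<^sup>2 + 1 / (real (i - k) + 1)\<^sup>2)" if "k \<le> i" for k
  proof -
    define p q where "p = real k + 1" and "q = real (i - k) + 1"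
    have pq: "p > 0" "q > 0" "real i + 1 = p + q - 1" "p + q \<ge> 2"
      using that by (auto simp: p_def q_def of_nat_diff)
    have "(real i + 1)\<^sup>2 \<le> (p + q)\<^sup>2"
      using pq by (intro power_mono) auto
    also have "\<dots> \<le> 2 * (p\<^sup>2 + q\<^sup>2)"
      using sum_squares_bound[of p q] by (simp add: power2_sum)
    finally have "(real i + 1)\<^sup>2 \<le> 2 * (p\<^sup>2 + q\<^sup>2)" .
    then have "(1 / p\<^sup>2) * (1 / q\<^sup>2) \<le> 2 * (1 / (real i + 1)\<^sup>2) * (1 / p\<^sup>2 + 1 / q\<^sup>2)"
      using pq(1,2) by (simp add: divide_simps)
    then show ?thesis by (simp add: p_def q_def)
  qed
  have r: "(\<Sum>k\<le>i. 1 / (real (i - k) + 1)\<^sup>2) = (\<Sum>k\<le>i. 1 / (real k + 1)\<^sup>2)"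
    by (rule sum.reindex_bij_witness[of _ "\<lambda>k. i - k" "\<lambda>k. i - k"]) auto
  have "(\<Sum>k\<le>i. (1 / (real k + 1)\<^sup>2) * (1 / (real (i - k) + 1)\<^sup>2))
      \<le> (\<Sum>k\<le>i. 2 * (1 / (real i + 1)\<^sup>2) * (1 / (real k + 1)\<^sup>2 + 1 / (real (i - k) + 1)\<^sup>2))"
    by (rule sum_mono) (use * in auto)
  also have "\<dots> = 2 * (1 / (real i + 1)\<^sup>2) * (2 * (\<Sum>k\<le>i. 1 / (real k + 1)\<^sup>2))"
    by (simp only: sum_distrib_left[symmetric] sum.distrib r) simp
  also have "\<dots> \<le> 2 * (1 / (real i + 1)\<^sup>2) * (2 * 2)"
    by (intro mult_left_mono order_trans[OF sum_inverse_squares_le]) auto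
  finally show ?thesis by simp
qed

text \<open>The powers of 64 multiply exactly and the inverse squares separate into the two index
  directions. Each direction costs a factor 8; that the product 64 equals the base in
  \<open>wt\<close> is a coincidence.\<close>

lemma majorized_conv:
  assumes "majorized M c" "majorized N d"
  shows "majorized (64 * M * N) (conv c d)"
  unfolding majorized_def
proof (intro allI)
  fix i j
  let ?v = "\<lambda>k::nat. 1 / (real k + 1)\<^sup>2"
  have MN: "0 \<le> M" "0 \<le> N" using assms majorized_nonneg by auto
  have "\<bar>conv c d i j\<bar> \<le> (\<Sum>k\<le>i. \<Sum>l\<le>j. (M * wt k l) * (N * wt (i - k) (j - l)))"
    unfolding conv_def
    by (intro order_trans[OF sum_abs] sum_mono) (auto simp: abs_mult intro!: mult_mono majorizedD assms mult_nonneg_nonneg MN)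
  also have "\<dots> = (\<Sum>k\<le>i. \<Sum>l\<le>j. (M * N / 64 ^ (i + j)) * ((?v k * ?v (i - k)) * (?v l * ?v (j - l))))"
  proof (intro sum.cong refl)
    fix k l assume "k \<in> {..i}" "l \<in> {..j}"
    then have "(64::real) ^ (i + j) = 64 ^ (k + l) * 64 ^ ((i - k) + (j - l))"
      by (simp flip: power_add)
    then show "(M * wt k l) * (N * wt (i - k) (j - l)) =
       (M * N / 64 ^ (i + j)) * ((?v k * ?v (i - k)) * (?v l * ?v (j - l)))"
      by (simp add: wt_def)
  qed
  also have "\<dots> = (M * N / 64 ^ (i + j)) * ((\<Sum>k\<le>i. ?v k * ?v (i - k)) * (\<Sum>l\<le>j. ?v l * ?v (j - l)))"
    unfolding sum_product by (simp only: sum_distrib_left)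
  also have "\<dots> \<le> (M * N / 64 ^ (i + j)) * ((8 * ?v i) * (8 * ?v j))"
    by (intro mult_left_mono mult_mono sum_inverse_squares_conv_le)
       (auto intro!: sum_nonneg mult_nonneg_nonneg simp: MN)
  also have "\<dots> = 64 * M * N * wt i j"
    by (simp add: wt_def mult_ac)
  finally show "\<bar>conv c d i j\<bar> \<le> 64 * M * N * wt i j" .
qed

lemma conv_diff:
  "conv c d i j - conv c' d' i j =
   conv (\<lambda>i j. c i j - c' i j) d i j + conv c' (\<lambda>i j. d i j - d' i j) i j"
  by (simp add: conv_def algebra_simps flip: sum_subtractf sum.distrib)

lemma majorized_conv_diff:
  assumes "majorized D (\<lambda>i j. c i j - c' i j)" "majorized E (\<lambda>i j. d i j - d' i j)"
    "majorized M c'" "majorized N d"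
  shows "majorized (64 * D * N + 64 * M * E) (\<lambda>i j. conv c d i j - conv c' d' i j)"
  using majorized_add[OF majorized_conv[OF assms(1,4)] majorized_conv[OF assms(3,2)]]
  by (simp add: conv_diff)

section \<open>The cubic nonlinearity on coefficient arrays\<close>

definition cube :: "(nat \<Rightarrow> nat \<Rightarrow> real) \<Rightarrow> nat \<Rightarrow> nat \<Rightarrow> real" where
  "cube c = conv (conv c c) c"

lemma majorized_cube: "majorized M c \<Longrightarrow> majorized (4096 * M ^ 3) (cube c)"
  using majorized_conv[OF majorized_conv, of M c M c M c] by (simp add: cube_def power3_eq_cube mult_ac)

text \<open>Changing one factor at a time: the difference of the squares contributes
  \<open>64 * 128\<close> and the difference of the last factor \<open>64 * 64\<close>, together
  12288.\<close>

lemma majorized_cube_diff: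
  assumes "majorized D (\<lambda>i j. c i j - c' i j)" "majorized M c" "majorized M c'"
  shows "majorized (12288 * M\<^sup>2 * D) (\<lambda>i j. cube c i j - cube c' i j)"
proof -
  have 1: "majorized (64 * D * M + 64 * M * D) (\<lambda>i j. conv c c i j - conv c' c' i j)"
    by (rule majorized_conv_diff) (use assms in auto)
  show ?thesis
    using majorized_conv_diff[OF 1 assms(1) majorized_conv[OF assms(3,3)] assms(2)]
    by (simp add: cube_def power2_eq_square algebra_simps)
qed

lemma cube_parity:
  assumes "\<And>i j. even j \<Longrightarrow> c i j = 0" "even j"
  shows "cube c i j = 0"
proof -
  have 1: "conv c c i j = 0" if "odd j" for i j
    unfolding conv_def
  proof (intro sum.neutral ballI)
    fix k l assume "k \<in> {..i}" "l \<in> {..j}"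
    then show "c k l * c (i - k) (j - l) = 0"
      using assms(1)[of l k] assms(1)[of "j - l" "i - k"] that by (cases "even l") auto
  qed
  show ?thesis
    unfolding cube_def conv_def[of "conv c c"]
  proof (intro sum.neutral ballI)
    fix k l assume "k \<in> {..i}" "l \<in> {..j}"
    then show "conv c c k l * c (i - k) (j - l) = 0"
      using 1[of l k] assms(1)[of "j - l" "i - k"] assms(2) by (cases "even l") auto
  qed
qed

text \<open>Every factor starts at order \<open>z\<close>, so the cube starts at \<open>z^3\<close>,
  and its coefficients there only see the entries \<open>c i 1\<close>. The first part serves the
  kernel index \<open>(1, 1)\<close>, the second the proof of nontriviality.\<close>

lemma cube_1:
  assumes "\<And>i. c i 0 = 0"
  shows "cube c i 1 = 0" "cube c 1 3 = 3 * (c 0 1)\<^sup>2 * c 1 1"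
proof -
  have 0: "conv c c i 0 = 0" "conv c c i 1 = 0" for i
    using assms by (simp_all add: conv_def)
  show "cube c i 1 = 0"
    using 0 by (simp add: cube_def conv_def[of "conv c c"])
  have a: "{..3::nat} = {0,1,2,3}" "{..2::nat} = {0,1,2}" "{..1::nat} = {0,1}" by auto
  show "cube c 1 3 = 3 * (c 0 1)\<^sup>2 * c 1 1"
    unfolding cube_def conv_def[of "conv c c"] a
    using 0 assms by (simp add: conv_def a power2_eq_square algebra_simps)
qed

subsection \<open>The fixed point equation for the coefficients\<close>

text \<open>The value of \<open>\<nu>\<close> forced by the equation at the kernel index \<open>(1, 1)\<close>, where \<open>c\<^sub>1\<^sub>1 = 1\<close> and
  the cubic term vanishes.\<close>

definition dispersion :: "real \<Rightarrow> (nat \<Rightarrow> nat \<Rightarrow> real) \<Rightarrow> real" where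
  "dispersion e c = 6 * e\<^sup>2 * c 3 1 + 6 * c 1 3"

text \<open>The diagonal part \<open>d (d + 1)\<close> of minus the Laplacian at degree
  \<open>d = i + j\<close>, shifted by the eigenvalue 6 of \<open>Y_2\<close>. It vanishes exactly
  at degree 2.\<close>

definition eigdiff :: "nat \<Rightarrow> nat \<Rightarrow> real" where
  "eigdiff i j = real (i + j) * (real (i + j) + 1) - 6"

definition residual :: "real \<Rightarrow> (nat \<Rightarrow> nat \<Rightarrow> real) \<Rightarrow> nat \<Rightarrow> nat \<Rightarrow> real" where
  "residual e c i j =
     e\<^sup>2 * (real i + 2) * (real i + 1) * c (i + 2) j + (real j + 2) * (real j + 1) * c i (j + 2)
     - dispersion e c * c i j - e * cube c i j"

text \<open>The entry at \<open>(0, 1)\<close> is the base flow \<open>z\<close>; the entry at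
  \<open>(1, 1)\<close> normalises the kernel direction \<open>xz\<close>.\<close>

definition base :: "nat \<Rightarrow> nat \<Rightarrow> real" where
  "base i j = (if i \<le> 1 \<and> j = 1 then 1 else 0)"

text \<open>At odd \<open>j\<close> away from the kernel index the equation is solved for
  \<open>eigdiff i j * c i j\<close>. The inhomogeneity 4 at \<open>(0, 1)\<close> is already
  contained in \<open>base\<close>, since \<open>eigdiff 0 1 = -4\<close>. All other entries are
  frozen at \<open>base\<close>: 0 for even \<open>j\<close> and 1 at \<open>(1, 1)\<close>.\<close>

definition step :: "real \<Rightarrow> (nat \<Rightarrow> nat \<Rightarrow> real) \<Rightarrow> nat \<Rightarrow> nat \<Rightarrow> real" where
  "step e c i j =
     base i j + (if odd j \<and> (i, j) \<noteq> (1, 1) then residual e c i j / eigdiff i j else 0)"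

section \<open>The contraction estimate\<close>

text \<open>For odd \<open>j\<close>, degree 2 occurs only at the excluded \<open>(1, 1)\<close>;
  what remains is \<open>(0, 1)\<close> and degrees at least 3, so there is no small divisor. The
  quadratic bounds let the division by \<open>eigdiff\<close> pay for two derivatives.\<close>

lemma eigdiff_bounds:
  assumes "odd j" "(i, j) \<noteq> (1, 1)"
  shows "4 \<le> \<bar>eigdiff i j\<bar>" "(real i + 2) * (real i + 1) \<le> 4 * \<bar>eigdiff i j\<bar>"
    "(real j + 2) * (real j + 1) \<le> 4 * \<bar>eigdiff i j\<bar>"
proof -
  define d where "d = i + j"
  have "4 \<le> \<bar>eigdiff i j\<bar> \<and> (real d + 2) * (real d + 1) \<le> 4 * \<bar>eigdiff i j\<bar>"
  proof (cases "d \<ge> 3")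
    case True
    then have "real d * 3 \<le> real d * real d" "real d \<ge> 3" by auto
    moreover have "eigdiff i j = real d * real d + real d - 6"
      by (simp add: eigdiff_def d_def algebra_simps)
    moreover have "(real d + 2) * (real d + 1) = real d * real d + 3 * real d + 2"
      by (simp add: algebra_simps)
    ultimately show ?thesis by linarith
  next
    case False
    with assms have "j = 1" "i = 0" unfolding d_def by (auto elim!: oddE)
    then show ?thesis by (simp add: eigdiff_def d_def)
  qed
  moreover have "(real i + 2) * (real i + 1) \<le> (real d + 2) * (real d + 1)"
    "(real j + 2) * (real j + 1) \<le> (real d + 2) * (real d + 1)"
    by (auto intro!: mult_mono simp: d_def)
  ultimately show "4 \<le> \<bar>eigdiff i j\<bar>" "(real i + 2) * (real i + 1) \<le> 4 * \<bar>eigdiff i j\<bar>"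
    "(real j + 2) * (real j + 1) \<le> 4 * \<bar>eigdiff i j\<bar>" by linarith+
qed

text \<open>Two degrees higher the weight has lost \<open>64^2 = 4096\<close>. This makes the
  off-diagonal part of the Laplacian small uniformly in the degree.\<close>

lemma wt_shift: "wt (i + 2) j \<le> wt i j / 4096" "wt i (j + 2) \<le> wt i j / 4096"
proof -
  have *: "1 / (real (i + 2) + 1)\<^sup>2 \<le> 1 / (real i + 1)\<^sup>2" for i
    by (intro divide_left_mono power_mono) auto
  show "wt (i + 2) j \<le> wt i j / 4096" "wt i (j + 2) \<le> wt i j / 4096"
    unfolding wt_def
    using mult_right_mono[OF *[of i], of "(1 / (real j + 1)\<^sup>2) / (64 ^ (i + j) * 4096)"]
          mult_right_mono[OF *[of j], of "(1 / (real i + 1)\<^sup>2) / (64 ^ (i + j) * 4096)"]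
    by (simp_all add: mult_ac)
qed

lemma majorized_base: "majorized (2 ^ 16) base"
proof -
  \<comment> \<open>The worst case is \<open>wt 1 1 = 2^-16\<close>.\<close>
  have "1 \<le> 2 ^ 16 * wt i 1" if "i \<le> 1" for i
    using that by (cases "i = 0") (auto simp: wt_def le_Suc_eq)
  then show ?thesis by (auto simp: majorized_def base_def)
qed

lemma majorized_near_base:
  assumes "majorized 1 (\<lambda>i j. c i j - base i j)"
  shows "majorized (2 ^ 17) c"
  using majorized_add[OF assms majorized_base] by (auto intro: majorized_mono)

lemma dispersion_le:
  assumes "majorized D h" "0 \<le> e" "e \<le> 1"
  shows "\<bar>dispersion e h\<bar> \<le> D / 2 ^ 26"
proof -
  have D: "0 \<le> D" using majorized_nonneg assms by auto
  \<comment> \<open>Both weights equal \<open>2^-30\<close>; the two coefficients 6 then add up to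
    less than \<open>2^4\<close>.\<close>
  have "\<bar>h 3 1\<bar> \<le> D / 2^30" "\<bar>h 1 3\<bar> \<le> D / 2^30"
    using majorizedD[OF assms(1), of 3 1] majorizedD[OF assms(1), of 1 3] by (simp_all add: wt_def)
  moreover have "\<bar>e\<^sup>2 * h 3 1\<bar> \<le> 1 * \<bar>h 3 1\<bar>"
    unfolding abs_mult using assms by (intro mult_right_mono) (auto simp: power_le_one)
  ultimately have "6 * \<bar>e\<^sup>2 * h 3 1\<bar> + 6 * \<bar>h 1 3\<bar> \<le> D / 2 ^ 26" using D by simp
  moreover have "\<bar>dispersion e h\<bar> \<le> 6 * \<bar>e\<^sup>2 * h 3 1\<bar> + 6 * \<bar>h 1 3\<bar>"
    unfolding dispersion_def by simp
  ultimately show ?thesis by linarith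
qed

lemma dispersion_base: "dispersion e base = 0"
  by (simp add: dispersion_def base_def)

lemma dispersion_diff:
  "dispersion e c - dispersion e c' = dispersion e (\<lambda>i j. c i j - c' i j)"
  by (simp add: dispersion_def algebra_simps)

text \<open>Three gains make the residual contract: the index shifts win 4096 against a loss of 4,
  \<open>dispersion\<close> only reads entries of weight \<open>2^-30\<close>, and the cubic term
  carries \<open>e\<close>. Terms without a factor \<open>eigdiff\<close> are absorbed through
  \<open>4 <= |eigdiff i j|\<close>.\<close>

lemma residual_diff_le:
  assumes e: "0 \<le> e" "e \<le> 1 / 2 ^ 60"
    and c: "majorized 1 (\<lambda>i j. c i j - base i j)" and c': "majorized 1 (\<lambda>i j. c' i j - base i j)"
    and D: "majorized D (\<lambda>i j. c i j - c' i j)"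
    and ij: "odd j" "(i, j) \<noteq> (1, 1)"
  shows "\<bar>residual e c i j - residual e c' i j\<bar> \<le> D / 2 * \<bar>eigdiff i j\<bar> * wt i j"
proof -
  define h where "h = (\<lambda>i j. c i j - c' i j)"
  define E where "E = \<bar>eigdiff i j\<bar>"
  note E = eigdiff_bounds[OF ij, folded E_def]
  have h: "majorized D h" using D by (simp add: h_def)
  have D0: "0 \<le> D" using majorized_nonneg h by auto
  have e1: "e \<le> 1" using e by simp
  let ?w = "wt i j"
  have eq: "residual e c i j - residual e c' i j =
      e\<^sup>2 * ((real i + 2) * (real i + 1)) * h (i + 2) j + ((real j + 2) * (real j + 1)) * h i (j + 2)
      - (dispersion e h * c i j + dispersion e c' * h i j) - e * (cube c i j - cube c' i j)"
    unfolding residual_def h_def dispersion_diff[symmetric] by (simp add: algebra_simps)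
  have 1: "\<bar>e\<^sup>2 * ((real i + 2) * (real i + 1)) * h (i + 2) j\<bar> \<le> (1 * (4 * E)) * (D * (?w / 4096))"
    unfolding abs_mult[of "_ * _" "h _ _"] abs_mult[of "e\<^sup>2"]
    using E e e1 D0 mult_left_mono[OF wt_shift(1)[of i j] D0]
    by (intro mult_mono[of _ "1 * (4 * E)"] mult_mono[of "\<bar>e\<^sup>2\<bar>" 1] order_trans[OF majorizedD[OF h]])
       (auto simp: power_le_one)
  have 2: "\<bar>((real j + 2) * (real j + 1)) * h i (j + 2)\<bar> \<le> (4 * E) * (D * (?w / 4096))"
    unfolding abs_mult[of "_ * _" "h _ _"]
    using E D0 mult_left_mono[OF wt_shift(2)[of i j] D0]
    by (intro mult_mono[of _ "4 * E"] order_trans[OF majorizedD[OF h]]) auto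
  have 3: "\<bar>dispersion e h * c i j\<bar> \<le> (D / 2 ^ 26) * (2 ^ 17 * ?w)"
    unfolding abs_mult using D0
    by (intro mult_mono dispersion_le h majorizedD[OF majorized_near_base[OF c]]) (use e1 e in auto)
  \<comment> \<open>As \<open>dispersion\<close> is linear and vanishes at \<open>base\<close>, only
    the distance of \<open>c'\<close> to \<open>base\<close> enters, not the size
    \<open>2^17\<close> of \<open>c'\<close>.\<close>
  have "dispersion e c' = dispersion e (\<lambda>i j. c' i j - base i j)"
    using dispersion_diff[of e c' base] by (simp add: dispersion_base)
  then have "\<bar>dispersion e c'\<bar> \<le> 1 / 2 ^ 26"
    using dispersion_le[OF c' e(1) e1] by simp
  then have 4: "\<bar>dispersion e c' * h i j\<bar> \<le> (1 / 2 ^ 26) * (D * ?w)"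
    unfolding abs_mult by (intro mult_mono majorizedD[OF h]) auto
  \<comment> \<open>With \<open>e <= 2^-60\<close> the cubic constant \<open>12288 * 2^34\<close>
    shrinks to \<open>3 / 2^14\<close>.\<close>
  have 5: "\<bar>e * (cube c i j - cube c' i j)\<bar> \<le> (1 / 2 ^ 60) * (12288 * (2 ^ 17)\<^sup>2 * D * ?w)"
    unfolding abs_mult using e
    by (intro mult_mono majorizedD[OF majorized_cube_diff[OF D majorized_near_base[OF c] majorized_near_base[OF c']]]) auto
  have E4: "4 * (D * ?w) \<le> E * (D * ?w)"
    using E(1) D0 by (intro mult_right_mono) auto
  have "\<bar>residual e c i j - residual e c' i j\<bar> \<le> D / 2 * E * ?w"
  proof -
    have *: "\<bar>a + b - (p + q) - r\<bar> \<le> \<bar>a\<bar> + \<bar>b\<bar> + \<bar>p\<bar> + \<bar>q\<bar> + \<bar>r\<bar>" for a b p q r :: real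
      by linarith
    have "(1 * (4 * E)) * (D * (?w / 4096)) + (4 * E) * (D * (?w / 4096)) + (D / 2 ^ 26) * (2 ^ 17 * ?w)
        + (1 / 2 ^ 26) * (D * ?w) + (1 / 2 ^ 60) * (12288 * (2 ^ 17)\<^sup>2 * D * ?w)
      = E * (D * ?w) / 512 + (1 / 512 + 1 / 2 ^ 26 + 3 / 2 ^ 14) * (D * ?w)"
      by (simp add: field_simps)
    also have "\<dots> \<le> E * (D * ?w) / 2"
    proof -
      have *: "a / 512 + (1 / 512 + 1 / 2 ^ 26 + 3 / 2 ^ 14) * b \<le> a / 2"
        if "4 * b \<le> a" "0 \<le> b" for a b :: real
        using that by simp
      show ?thesis by (rule *[OF E4 mult_nonneg_nonneg[OF D0 wt_nonneg]])
    qed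
    also have "\<dots> = D / 2 * E * ?w" by simp
    finally show ?thesis
      unfolding eq using 1 2 3 4 5 by (intro order_trans[OF *]) linarith
  qed
  then show ?thesis by (simp add: E_def)
qed

lemma step_diff:
  assumes "0 \<le> e" "e \<le> 1 / 2 ^ 60"
    and "majorized 1 (\<lambda>i j. c i j - base i j)" and "majorized 1 (\<lambda>i j. c' i j - base i j)"
    and D: "majorized D (\<lambda>i j. c i j - c' i j)"
  shows "majorized (D / 2) (\<lambda>i j. step e c i j - step e c' i j)"
  unfolding majorized_def
proof (intro allI)
  fix i j
  have D0: "0 \<le> D" using majorized_nonneg D by auto
  show "\<bar>step e c i j - step e c' i j\<bar> \<le> D / 2 * wt i j"
  proof (cases "odd j \<and> (i, j) \<noteq> (1, 1)")
    case True
    then have "\<bar>residual e c i j - residual e c' i j\<bar> \<le> D / 2 * \<bar>eigdiff i j\<bar> * wt i j" "0 < \<bar>eigdiff i j\<bar>"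
      using residual_diff_le[OF assms] eigdiff_bounds(1)[of j i] by auto
    then have "\<bar>residual e c i j - residual e c' i j\<bar> / \<bar>eigdiff i j\<bar> \<le> D / 2 * wt i j"
      by (simp add: divide_simps mult_ac)
    then show ?thesis using True by (simp add: step_def flip: diff_divide_distrib abs_divide)
  next
    case False
    then show ?thesis using D0 by (auto simp: step_def)
  qed
qed

text \<open>At \<open>base\<close> only the cubic term of the residual survives. Its constant is
  \<open>4096 * (2^16)^3 = 2^60\<close>, and dividing by \<open>|eigdiff i j| >= 4\<close> leaves
  \<open>2^58\<close>.\<close>

lemma step_base:
  assumes "0 \<le> e"
  shows "majorized (e * 2 ^ 58) (\<lambda>i j. step e base i j - base i j)"
  unfolding majorized_def
proof (intro allI)
  fix i j
  show "\<bar>step e base i j - base i j\<bar> \<le> e * 2 ^ 58 * wt i j"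
  proof (cases "odd j \<and> (i, j) \<noteq> (1, 1)")
    case True
    then have 4: "4 \<le> \<bar>eigdiff i j\<bar>" using eigdiff_bounds(1)[of j i] by auto
    have "base (Suc (Suc i)) j = 0" "base i (Suc (Suc j)) = 0" by (auto simp: base_def)
    then have r: "residual e base i j = - (e * cube base i j)"
      by (simp add: residual_def dispersion_base)
    have "\<bar>e * cube base i j\<bar> \<le> e * (4096 * (2 ^ 16) ^ 3 * wt i j)"
      unfolding abs_mult using assms by (intro mult_mono majorizedD[OF majorized_cube[OF majorized_base]]) auto
    then have "\<bar>residual e base i j\<bar> \<le> 4 * (e * 2 ^ 58 * wt i j)" by (simp add: r mult_ac)
    also have "\<dots> \<le> \<bar>eigdiff i j\<bar> * (e * 2 ^ 58 * wt i j)"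
      using 4 assms by (intro mult_right_mono) auto
    finally have "\<bar>residual e base i j\<bar> / \<bar>eigdiff i j\<bar> \<le> e * 2 ^ 58 * wt i j"
      using 4 by (simp add: divide_simps mult_ac)
    then show ?thesis using True by (simp add: step_def)
  next
    case False
    then show ?thesis using assms by (auto simp: step_def)
  qed
qed

section \<open>Existence of the coefficients\<close>

text \<open>Picard iteration from \<open>base\<close>. The first move has size at most
  \<open>K\<close> and each later one at most half of the previous, so the iterates stay within
  \<open>2 K <= 1\<close> of \<open>base\<close>, where \<open>step_diff\<close> applies. Limits are
  taken entry by entry.\<close>

lemma fixed_point:
  assumes e: "0 \<le> e" "e \<le> 1 / 2 ^ 60"
  obtains c where "majorized (e * 2 ^ 59) (\<lambda>i j. c i j - base i j)" "\<And>i j. step e c i j = c i j"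
proof -
  define X where "X = (\<lambda>n. (step e ^^ n) base)"
  define K where "K = e * 2 ^ 58"
  have K: "0 \<le> K" "2 * K \<le> 1" using e by (auto simp: K_def)
  have X: "X 0 = base" "X (Suc n) = step e (X n)" for n by (auto simp: X_def)
  \<comment> \<open>The first bound is the partial geometric sum of the moves made so far; it keeps
    the iterates where the halving in the second bound is available.\<close>
  have inv: "majorized (2 * K * (1 - 1 / 2 ^ n)) (\<lambda>i j. X n i j - base i j) \<and>
    majorized (K / 2 ^ n) (\<lambda>i j. X (Suc n) i j - X n i j)" for n
  proof (induction n)
    case 0
    show ?case using step_base[OF e(1)] by (simp add: X K_def majorized_def)
  next
    case (Suc n)
    then have 1: "majorized (2 * K * (1 - 1 / 2 ^ n)) (\<lambda>i j. X n i j - base i j)"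
      and 2: "majorized (K / 2 ^ n) (\<lambda>i j. X (Suc n) i j - X n i j)" by auto
    have 3: "majorized (2 * K * (1 - 1 / 2 ^ Suc n)) (\<lambda>i j. X (Suc n) i j - base i j)"
    proof -
      have "K / 2 ^ n + 2 * K * (1 - 1 / 2 ^ n) = 2 * K * (1 - 1 / 2 ^ Suc n)"
        by (simp add: field_simps)
      then show ?thesis using majorized_add[OF 2 1] by simp
    qed
    have le: "2 * K * (1 - 1 / 2 ^ n) \<le> 1" for n :: nat
      using K mult_left_mono[of "1 - 1 / 2 ^ n" 1 "2 * K"] by simp
    have "majorized (K / 2 ^ n / 2) (\<lambda>i j. step e (X (Suc n)) i j - step e (X n) i j)"
      using step_diff[OF e majorized_mono[OF 3 le] majorized_mono[OF 1 le] 2] .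
    then show ?case using 3 by (simp add: X(2)[of "Suc n"] X(2)[of n] mult.commute)
  qed
  have conv: "\<exists>L. (\<lambda>n. X n i j) \<longlonglongrightarrow> L" for i j
  proof -
    have "summable (\<lambda>n. X (Suc n) i j - X n i j)"
    proof (rule summable_comparison_test')
      show "summable (\<lambda>n. (K * wt i j) * (1 / 2) ^ n)"
        by (intro summable_mult summable_geometric) simp
      show "norm (X (Suc n) i j - X n i j) \<le> (K * wt i j) * (1 / 2) ^ n" if "n \<ge> 0" for n
        using majorizedD[OF conjunct2[OF inv[of n]], of i j] by (simp add: power_one_over field_simps)
    qed
    then obtain L where "(\<lambda>n. X n i j - X 0 i j) \<longlonglongrightarrow> L"
      using summable_LIMSEQ[of "\<lambda>n. X (Suc n) i j - X n i j"]
        sum_lessThan_telescope[of "\<lambda>n. X n i j"] by auto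
    then show ?thesis
      using tendsto_add[OF _ tendsto_const, of _ L sequentially "X 0 i j"] by fastforce
  qed
  then obtain c where c: "\<And>i j. (\<lambda>n. X n i j) \<longlonglongrightarrow> c i j" by metis
  have "(\<lambda>n. step e (X n) i j) \<longlonglongrightarrow> step e c i j" for i j
  proof (cases "odd j \<and> (i, j) \<noteq> (1, 1)")
    case True
    \<comment> \<open>Each entry of the residual reads only finitely many entries of the array, so
      entrywise convergence suffices.\<close>
    have "(\<lambda>n. residual e (X n) i j) \<longlonglongrightarrow> residual e c i j"
      unfolding residual_def dispersion_def cube_def conv_def by (intro tendsto_intros c)
    then show ?thesis
      using eigdiff_bounds(1)[of j i] True unfolding step_def by (auto intro!: tendsto_intros)
  next
    case False
    then show ?thesis unfolding step_def by (simp only: if_False tendsto_const)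
  qed
  moreover have "(\<lambda>n. step e (X n) i j) \<longlonglongrightarrow> c i j" for i j
    using LIMSEQ_Suc[OF c[of i j]] by (simp add: X)
  ultimately have "step e c i j = c i j" for i j
    using LIMSEQ_unique by blast
  moreover have "majorized (2 * K) (\<lambda>i j. c i j - base i j)"
    unfolding majorized_def
  proof (intro allI)
    fix i j
    have "(\<lambda>n. \<bar>X n i j - base i j\<bar>) \<longlonglongrightarrow> \<bar>c i j - base i j\<bar>"
      by (intro tendsto_intros c)
    moreover have "\<bar>X n i j - base i j\<bar> \<le> 2 * K * wt i j" for n
    proof -
      have "2 * K * (1 - 1 / 2 ^ n) \<le> 2 * K" using K mult_left_mono[of "1 - 1 / 2 ^ n" 1 "2 * K"] by simp
      then show ?thesis using majorizedD[OF majorized_mono[OF conjunct1[OF inv[of n]]]] by blast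
    qed
    ultimately show "\<bar>c i j - base i j\<bar> \<le> 2 * K * wt i j"
      by (intro LIMSEQ_le_const2) auto
  qed
  ultimately show ?thesis using that by (simp add: K_def mult_ac)
qed

lemma coefficients_exist:
  assumes e: "0 < e" "e \<le> 1 / 2 ^ 60"
  obtains c where "majorized (e * 2 ^ 59) (\<lambda>i j. c i j - base i j)" "c 1 1 = 1"
    "\<And>i j. e\<^sup>2 * (real i + 2) * (real i + 1) * c (i + 2) j + (real j + 2) * (real j + 1) * c i (j + 2)
       - eigdiff i j * c i j = dispersion e c * c i j + e * cube c i j + (if (i, j) = (0, 1) then 4 else 0)"
    "\<And>i j. even j \<Longrightarrow> c i j = 0" "\<not> (c 1 3 = 0 \<and> c 1 5 = 0)"
proof -
  obtain c where c: "majorized (e * 2 ^ 59) (\<lambda>i j. c i j - base i j)" "\<And>i j. step e c i j = c i j"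
    using fixed_point[of e] e by auto
  have ev: "c i j = 0" if "even j" for i j
    using c(2)[of i j] that by (auto simp: step_def base_def)
  have c11: "c 1 1 = 1"
    using c(2)[of 1 1] by (auto simp: step_def base_def)
  have eq: "e\<^sup>2 * (real i + 2) * (real i + 1) * c (i + 2) j + (real j + 2) * (real j + 1) * c i (j + 2)
       - eigdiff i j * c i j = dispersion e c * c i j + e * cube c i j + (if (i, j) = (0, 1) then 4 else 0)" for i j
  proof (cases "even j")
    case True
    then show ?thesis using cube_parity[of c j i] ev by (auto simp: ev)
  next
    case odd: False
    show ?thesis
    proof (cases "(i, j) = (1, 1)")
      case True
      then show ?thesis
        using cube_1(1)[of c 1] ev c11 by (simp add: dispersion_def eigdiff_def)
          (simp add: numeral_3_eq_3)
    next
      case False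
      then have "c i j = base i j + residual e c i j / eigdiff i j" "eigdiff i j \<noteq> 0"
        using c(2)[of i j] odd eigdiff_bounds(1)[of j i] by (auto simp: step_def)
      then have "eigdiff i j * c i j = eigdiff i j * base i j + residual e c i j"
        by (simp add: field_simps)
      moreover have "eigdiff i j * base i j = - (if (i, j) = (0, 1) then 4 else 0)"
        using False by (auto simp: base_def eigdiff_def)
      ultimately show ?thesis by (simp add: residual_def)
    qed
  qed
  have "\<not> (c 1 3 = 0 \<and> c 1 5 = 0)"
  proof
    assume "c 1 3 = 0 \<and> c 1 5 = 0"
    then have "6 * e\<^sup>2 * c 3 3 = e * (3 * (c 0 1)\<^sup>2)"
      using eq[of 1 3] cube_1(2)[of c] ev c11 by (simp add: numeral_eq_Suc)
    then have "2 * e * c 3 3 = (c 0 1)\<^sup>2"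
      using e by (simp add: power2_eq_square)
    moreover have "\<bar>c 3 3\<bar> \<le> 1 / 2" "\<bar>c 0 1 - 1\<bar> \<le> 1 / 128"
      using majorizedD[OF c(1), of 3 3] majorizedD[OF c(1), of 0 1] e by (simp_all add: base_def wt_def)
    moreover have "(1/2)\<^sup>2 \<le> (c 0 1)\<^sup>2"
      by (rule power_mono) (use calculation(3) in linarith)+
    moreover have "\<bar>2 * e * c 3 3\<bar> \<le> (2 * (1 / 2^60)) * (1 / 2)"
      unfolding abs_mult using e calculation(2) by (intro mult_mono) auto
    ultimately show False by (simp add: power2_eq_square)
  qed
  then show ?thesis using that[of c] c c11 eq ev by blast
qed

subsection \<open>Double power series\<close>

lemma has_sum_times:
  fixes f :: "'a \<Rightarrow> real" and g :: "'b \<Rightarrow> real"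
  assumes "f summable_on A" "g summable_on B"
  shows "((\<lambda>(x, y). f x * g y) has_sum (infsum f A * infsum g B)) (A \<times> B)"
proof (rule has_sum_SigmaI)
  have fa: "(\<lambda>x. \<bar>f x\<bar>) summable_on A" and ga: "(\<lambda>x. \<bar>g x\<bar>) summable_on B"
    using assms summable_on_iff_abs_summable_on_real by force+
  have "(\<lambda>(x, y). \<bar>f x\<bar> * \<bar>g y\<bar>) summable_on A \<times> B"
    by (rule summable_on_SigmaI[where g = "\<lambda>x. \<bar>f x\<bar> * infsum (\<lambda>x. \<bar>g x\<bar>) B"])
       (use fa ga in \<open>auto intro!: has_sum_cmult_right summable_on_cmult_left\<close>)
  then have "(\<lambda>z. norm (case z of (x, y) \<Rightarrow> f x * g y)) summable_on A \<times> B"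
    by (simp add: case_prod_unfold abs_mult)
  then show "(\<lambda>(x, y). f x * g y) summable_on A \<times> B"
    by (rule abs_summable_summable)
  show "((\<lambda>x. f x * infsum g B) has_sum (infsum f A * infsum g B)) A"
    by (intro has_sum_cmult_left has_sum_infsum assms)
  show "((\<lambda>y. (case (x, y) of (x, y) \<Rightarrow> f x * g y)) has_sum (f x * infsum g B)) B" if "x \<in> A" for x
    using assms by (auto intro!: has_sum_cmult_right)
qed

text \<open>Used for differentiation, which kills the terms of index 0, and for multiplication by a
  variable, which creates none.\<close>

lemma has_sum_shift:
  fixes f :: "nat \<times> nat \<Rightarrow> real"
  shows "((\<lambda>(i, j). f (Suc i, j)) has_sum v) UNIV \<Longrightarrow> (\<And>j. f (0, j) = 0) \<Longrightarrow> (f has_sum v) UNIV"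
    and "((\<lambda>(i, j). f (i, Suc j)) has_sum v) UNIV \<Longrightarrow> (\<And>i. f (i, 0) = 0) \<Longrightarrow> (f has_sum v) UNIV"
proof -
  assume h: "((\<lambda>(i, j). f (Suc i, j)) has_sum v) UNIV" "\<And>j. f (0, j) = 0"
  have "(f has_sum v) (range (\<lambda>(i, j). (Suc i, j)))"
    by (subst has_sum_reindex) (use h(1) in \<open>auto simp: inj_on_def o_def case_prod_unfold\<close>)
  moreover have "f p = 0" if "p \<notin> range (\<lambda>(i, j). (Suc i, j))" for p
    using that h(2) by (cases p; cases "fst p") (auto simp: image_iff)
  ultimately show "(f has_sum v) UNIV"
    using has_sum_cong_neutral[of UNIV "range (\<lambda>(i, j). (Suc i, j))" f f v] by auto
next
  assume h: "((\<lambda>(i, j). f (i, Suc j)) has_sum v) UNIV" "\<And>i. f (i, 0) = 0"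
  have "(f has_sum v) (range (\<lambda>(i, j). (i, Suc j)))"
    by (subst has_sum_reindex) (use h(1) in \<open>auto simp: inj_on_def o_def case_prod_unfold\<close>)
  moreover have "f p = 0" if "p \<notin> range (\<lambda>(i, j). (i, Suc j))" for p
    using that h(2) by (cases p; cases "snd p") (auto simp: image_iff)
  ultimately show "(f has_sum v) UNIV"
    using has_sum_cong_neutral[of UNIV "range (\<lambda>(i, j). (i, Suc j))" f f v] by auto
qed

text \<open>On the right, the outer index is the total exponent and the inner one the share of the
  first factor. From left to right this gives the Cauchy product, from right to left the regrouping
  of binomial expansions.\<close>

lemma has_sum_antidiagonals:
  fixes F :: "(nat \<times> nat) \<times> (nat \<times> nat) \<Rightarrow> real"
  shows "(F has_sum v) UNIV \<longleftrightarrow>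
    ((\<lambda>((i, j), (k, l)). F ((k, l), (i - k, j - l))) has_sum v) (Sigma UNIV (\<lambda>(i, j). {..i} \<times> {..j}))"
  by (rule has_sum_reindex_bij_witness
        [of _ "\<lambda>((i, j), (k, l)). ((k, l), (i - k, j - l))" "\<lambda>((k, l), (m, n)). ((k + m, l + n), (k, l))"])
     auto

definition series2 :: "(nat \<Rightarrow> nat \<Rightarrow> real) \<Rightarrow> real \<Rightarrow> real \<Rightarrow> real" where
  "series2 c x z = (\<Sum>\<^sub>\<infinity>(i, j). c i j * x ^ i * z ^ j)"

text \<open>A qualitative form of \<open>majorized\<close> that records only a radius of
  convergence, which is all that differentiation and recentering require.\<close>

definition geo_bounded :: "real \<Rightarrow> (nat \<Rightarrow> nat \<Rightarrow> real) \<Rightarrow> bool" where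
  "geo_bounded r c \<longleftrightarrow> r > 0 \<and> (\<exists>M. \<forall>i j. \<bar>c i j\<bar> \<le> M / r ^ (i + j))"

lemma geometric2_has_sum:
  fixes s t :: real
  assumes "0 \<le> s" "s < 1" "0 \<le> t" "t < 1"
  shows "((\<lambda>(i, j). s ^ i * t ^ j) has_sum (1 / (1 - s) * (1 / (1 - t)))) UNIV"
proof -
  have *: "((\<lambda>i. s ^ i) has_sum (1 / (1 - s))) UNIV" if "0 \<le> s" "s < 1" for s :: real
    by (rule sums_nonneg_imp_has_sum) (use that geometric_sums[of s] in auto)
  then show ?thesis
    using has_sum_times[of "\<lambda>i. s ^ i" UNIV "\<lambda>i. t ^ i" UNIV] has_sum_imp_summable[OF *[of s]]
      has_sum_imp_summable[OF *[of t]] infsumI[OF *[of s]] infsumI[OF *[of t]] assms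
    by simp
qed

lemma geo_bounded_terms:
  assumes "geo_bounded r c" "0 \<le> s" "s < r" "0 \<le> t" "t < r"
  shows "(\<lambda>(i, j). \<bar>c i j\<bar> * s ^ i * t ^ j) summable_on UNIV"
proof -
  obtain M where r: "r > 0" and M: "\<And>i j. \<bar>c i j\<bar> \<le> M / r ^ (i + j)"
    using assms(1) unfolding geo_bounded_def by auto
  have "(\<lambda>(i, j). (s / r) ^ i * (t / r) ^ j) summable_on UNIV"
    by (rule has_sum_imp_summable[OF geometric2_has_sum]) (use assms r in auto)
  then have "(\<lambda>p. M * (case p of (i, j) \<Rightarrow> (s / r) ^ i * (t / r) ^ j)) summable_on UNIV"
    by (rule summable_on_cmult_right)
  then show ?thesis
  proof (rule summable_on_comparison_test)
    fix p :: "nat \<times> nat"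
    obtain i j where p: "p = (i, j)" by (cases p)
    have "\<bar>c i j\<bar> * s ^ i * t ^ j \<le> M / r ^ (i + j) * s ^ i * t ^ j"
      using assms M by (intro mult_right_mono) auto
    then show "(case p of (i, j) \<Rightarrow> \<bar>c i j\<bar> * s ^ i * t ^ j) \<le>
        M * (case p of (i, j) \<Rightarrow> (s / r) ^ i * (t / r) ^ j)"
      using r by (simp add: p power_divide power_add mult_ac)
    show "0 \<le> (case p of (i, j) \<Rightarrow> \<bar>c i j\<bar> * s ^ i * t ^ j)"
      using assms by (simp add: p)
  qed
qed

lemma series2_has_sum:
  assumes "geo_bounded r c" "\<bar>x\<bar> < r" "\<bar>z\<bar> < r"
  shows "((\<lambda>(i, j). c i j * x ^ i * z ^ j) has_sum series2 c x z) UNIV"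
proof -
  have "(\<lambda>(i, j). \<bar>c i j\<bar> * \<bar>x\<bar> ^ i * \<bar>z\<bar> ^ j) summable_on UNIV"
    by (rule geo_bounded_terms) (use assms in auto)
  then have "(\<lambda>p. norm (case p of (i, j) \<Rightarrow> c i j * x ^ i * z ^ j)) summable_on UNIV"
    by (simp add: case_prod_unfold abs_mult power_abs)
  from abs_summable_summable[OF this] show ?thesis
    unfolding series2_def by (rule has_sum_infsum)
qed

lemma series2_eqI: "((\<lambda>(i, j). c i j * x ^ i * z ^ j) has_sum v) UNIV \<Longrightarrow> series2 c x z = v"
  unfolding series2_def by (rule infsumI)

section \<open>Termwise operations on double power series\<close>

definition dX :: "(nat \<Rightarrow> nat \<Rightarrow> real) \<Rightarrow> nat \<Rightarrow> nat \<Rightarrow> real" where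
  "dX c i j = (real i + 1) * c (Suc i) j"

definition dZ :: "(nat \<Rightarrow> nat \<Rightarrow> real) \<Rightarrow> nat \<Rightarrow> nat \<Rightarrow> real" where
  "dZ c i j = (real j + 1) * c i (Suc j)"

text \<open>The factor \<open>k + 1\<close> produced by the derivative is at most \<open>2^n\<close>
  in total degree \<open>n\<close>, and halving the radius absorbs it. The initial radius 64 leaves
  room for all derivatives taken later.\<close>

lemma geo_bounded_dX: "geo_bounded r c \<Longrightarrow> geo_bounded (r / 2) (dX c)"
  and geo_bounded_dZ: "geo_bounded r c \<Longrightarrow> geo_bounded (r / 2) (dZ c)"
proof -
  assume "geo_bounded r c"
  then obtain M where r: "r > 0" and M: "\<And>i j. \<bar>c i j\<bar> \<le> M / r ^ (i + j)"
    unfolding geo_bounded_def by auto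
  have M0: "0 \<le> M" using M[of 0 0] by simp
  have *: "(real k + 1) * \<bar>y\<bar> \<le> (M / r) / (r / 2) ^ n" if "\<bar>y\<bar> \<le> M / r ^ Suc n" "k \<le> n" for k n y
  proof -
    have "k + 1 \<le> 2 ^ n" using that(2) less_exp[of n] by linarith
    then have "real (k + 1) \<le> real (2 ^ n)" by (rule of_nat_mono)
    then have "real k + 1 \<le> 2 ^ n" by simp
    then have "(real k + 1) * \<bar>y\<bar> \<le> 2 ^ n * (M / r ^ Suc n)"
      using that M0 r by (intro mult_mono) auto
    also have "\<dots> = (M / r) / (r / 2) ^ n" using r by (simp add: power_divide)
    finally show ?thesis .
  qed
  have "\<bar>dX c i j\<bar> \<le> (M / r) / (r / 2) ^ (i + j)" "\<bar>dZ c i j\<bar> \<le> (M / r) / (r / 2) ^ (i + j)" for i j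
    using *[of "c (Suc i) j" "i + j" i] M[of "Suc i" j] *[of "c i (Suc j)" "i + j" j] M[of i "Suc j"]
    by (simp_all add: dX_def dZ_def abs_mult)
  then show "geo_bounded (r / 2) (dX c)" "geo_bounded (r / 2) (dZ c)"
    using r unfolding geo_bounded_def by (meson half_gt_zero)+
qed

lemma has_sum_dX:
  assumes "geo_bounded r c" "\<bar>x\<bar> < r / 2" "\<bar>z\<bar> < r / 2"
  shows "((\<lambda>(i, j). c i j * (real i * x ^ (i - 1)) * z ^ j) has_sum series2 (dX c) x z) UNIV"
  by (rule has_sum_shift(1))
     (use series2_has_sum[OF geo_bounded_dX[OF assms(1)] assms(2,3)] in \<open>auto simp: dX_def mult_ac add.commute\<close>)

lemma has_sum_dZ:
  assumes "geo_bounded r c" "\<bar>x\<bar> < r / 2" "\<bar>z\<bar> < r / 2"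
  shows "((\<lambda>(i, j). c i j * x ^ i * (real j * z ^ (j - 1))) has_sum series2 (dZ c) x z) UNIV"
  by (rule has_sum_shift(2))
     (use series2_has_sum[OF geo_bounded_dZ[OF assms(1)] assms(2,3)] in \<open>auto simp: dZ_def mult_ac add.commute\<close>)

lemma has_sum_mult_x:
  fixes c :: "nat \<Rightarrow> nat \<Rightarrow> real"
  assumes "((\<lambda>(i, j). c i j * x ^ i * z ^ j) has_sum v) UNIV"
  shows "((\<lambda>(i, j). (if i = 0 then 0 else c (i - 1) j) * x ^ i * z ^ j) has_sum x * v) UNIV"
  by (rule has_sum_shift(1))
     (use has_sum_cmult_right[OF assms, of x] in \<open>auto simp: case_prod_unfold mult_ac\<close>)

lemma has_sum_mult_z:
  fixes c :: "nat \<Rightarrow> nat \<Rightarrow> real"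
  assumes "((\<lambda>(i, j). c i j * x ^ i * z ^ j) has_sum v) UNIV"
  shows "((\<lambda>(i, j). (if j = 0 then 0 else c i (j - 1)) * x ^ i * z ^ j) has_sum z * v) UNIV"
  by (rule has_sum_shift(2))
     (use has_sum_cmult_right[OF assms, of z] in \<open>auto simp: case_prod_unfold mult_ac\<close>)

lemma series2_conv:
  assumes "geo_bounded r c" "geo_bounded r d" "\<bar>x\<bar> < r" "\<bar>z\<bar> < r"
  shows "series2 (conv c d) x z = series2 c x z * series2 d x z"
proof (rule series2_eqI)
  let ?f = "\<lambda>c (i, j). c i j * x ^ i * z ^ j :: real"
  let ?F = "\<lambda>(p, q). ?f c p * ?f d q"
  have f: "(?f c has_sum series2 c x z) UNIV" "(?f d has_sum series2 d x z) UNIV"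
    using series2_has_sum assms by auto
  have "(?F has_sum (infsum (?f c) UNIV * infsum (?f d) UNIV)) (UNIV \<times> UNIV)"
    by (rule has_sum_times) (use f has_sum_imp_summable in auto)
  then have "(?F has_sum (series2 c x z * series2 d x z)) UNIV"
    using f by (simp only: infsumI UNIV_Times_UNIV)
  then have "((\<lambda>((i, j), (k, l)). ?F ((k, l), (i - k, j - l))) has_sum (series2 c x z * series2 d x z))
     (Sigma UNIV (\<lambda>(i, j). {..i} \<times> {..j}))"
    by (subst (asm) has_sum_antidiagonals)
  then show "((\<lambda>(i, j). conv c d i j * x ^ i * z ^ j) has_sum (series2 c x z * series2 d x z)) UNIV"
  proof (rule has_sum_SigmaD, goal_cases)
    case (1 p)
    obtain i j where p: "p = (i, j)" by (cases p)
    have "?F ((k, l), (i - k, j - l)) = c k l * d (i - k) (j - l) * x ^ i * z ^ j" if "k \<le> i" "l \<le> j" for k l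
    proof -
      have "x ^ i = x ^ k * x ^ (i - k)" "z ^ j = z ^ l * z ^ (j - l)"
        using that by (simp_all flip: power_add)
      then show ?thesis by (simp only: prod.case mult_ac)
    qed
    then have "(\<Sum>(k, l)\<in>{..i} \<times> {..j}. ?F ((k, l), (i - k, j - l))) = conv c d i j * x ^ i * z ^ j"
      unfolding conv_def sum_distrib_right sum.cartesian_product by (intro sum.cong) auto
    then show ?case
      by (intro has_sum_finiteI) (auto simp: p)
  qed
qed

text \<open>On a square of half-width \<open>s < r / 2\<close> around the origin that contains the
  point, the differentiated terms are dominated by the summable \<open>B\<close>, so the tails are
  uniformly small and termwise differentiation is justified. The pairs are enumerated by
  \<open>prod_decode\<close> because \<open>has_derivative_series\<close> is about
  sequences.\<close>

lemma series2_has_derivative: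
  assumes c: "geo_bounded r c" and xz: "\<bar>x\<bar> < r / 2" "\<bar>z\<bar> < r / 2"
  shows "((\<lambda>(x, z). series2 c x z) has_derivative
     (\<lambda>(h, k). series2 (dX c) x z * h + series2 (dZ c) x z * k)) (at (x, z))"
proof -
  define s where "s = (max \<bar>x\<bar> \<bar>z\<bar> + r / 2) / 2"
  have s: "0 \<le> s" "s < r / 2" "\<bar>x\<bar> < s" "\<bar>z\<bar> < s" using xz by (auto simp: s_def)
  have r: "r > 0" using c by (simp add: geo_bounded_def)
  define S where "S = {-s<..<s} \<times> {-s<..<s}"
  have S: "open S" "convex S" "(x, z) \<in> S" using s by (auto simp: S_def open_Times convex_Times)
  define T where "T = (\<lambda>p (x, z). case p of (i, j) \<Rightarrow> c i j * x ^ i * z ^ j)"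
  define D where "D = (\<lambda>p (x, z) (h, k). case p of (i, j) \<Rightarrow>
      c i j * (real i * x ^ (i - 1)) * z ^ j * h + c i j * x ^ i * (real j * z ^ (j - 1)) * k)"
  define B where "B = (\<lambda>(i, j). \<bar>c i j\<bar> * (real i * s ^ (i - 1)) * s ^ j + \<bar>c i j\<bar> * s ^ i * (real j * s ^ (j - 1)))"
  define G where "G = (\<lambda>(x, z) (h, k). series2 (dX c) x z * h + series2 (dZ c) x z * k)"
  have ca: "geo_bounded r (\<lambda>i j. \<bar>c i j\<bar>)" using c by (simp add: geo_bounded_def)
  have "B summable_on UNIV"
    unfolding B_def
    using summable_on_add[OF has_sum_imp_summable[OF has_sum_dX[OF ca]] has_sum_imp_summable[OF has_sum_dZ[OF ca]], of s s s s] s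
    by (simp add: case_prod_unfold)
  then have "(B \<circ> prod_decode) summable_on UNIV"
    using summable_on_reindex_bij_betw[OF bij_prod_decode, of B] by (simp add: o_def)
  then have Bs: "summable (\<lambda>n. B (prod_decode n))"
    by (simp add: summable_on_imp_summable o_def)
  have sums: "(\<lambda>n. F (prod_decode n)) sums v" if "(F has_sum v) UNIV" for F :: "nat \<times> nat \<Rightarrow> real" and v
    using has_sum_reindex_bij_betw[OF bij_prod_decode, of F v] that has_sum_imp_sums by blast
  have Ts: "(\<lambda>n. T (prod_decode n) (x, z)) sums series2 c x z" if "(x, z) \<in> S" for x z
    by (rule sums) (use series2_has_sum[OF c, of x z] that s r in \<open>auto simp: T_def S_def\<close>)
  have Ds: "(\<lambda>n. D (prod_decode n) (x, z) (h, k)) sums G (x, z) (h, k)" if "(x, z) \<in> S" for x z h k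
  proof (rule sums)
    have "\<bar>x\<bar> < r / 2" "\<bar>z\<bar> < r / 2" using that s by (auto simp: S_def)
    from has_sum_add[OF has_sum_cmult_left[OF has_sum_dX[OF c this], of h] has_sum_cmult_left[OF has_sum_dZ[OF c this], of k]]
    show "((\<lambda>p. D p (x, z) (h, k)) has_sum G (x, z) (h, k)) UNIV"
      by (simp add: D_def G_def case_prod_unfold)
  qed
  have Db: "\<bar>D p y w\<bar> \<le> B p * norm w" if "y \<in> S" for p y w
  proof -
    obtain i j where p: "p = (i, j)" by (cases p)
    obtain x z where y: "y = (x, z)" by (cases y)
    obtain h k where w: "w = (h, k)" by (cases w)
    have xz: "\<bar>x\<bar> \<le> s" "\<bar>z\<bar> \<le> s" using that y by (auto simp: S_def)
    have hk: "\<bar>h\<bar> \<le> norm w" "\<bar>k\<bar> \<le> norm w"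
      using norm_fst_le[of h k] norm_snd_le[of k h] by (auto simp: w)
    have "\<bar>D p y w\<bar> \<le> \<bar>c i j * (real i * x ^ (i - 1)) * z ^ j * h\<bar> + \<bar>c i j * x ^ i * (real j * z ^ (j - 1)) * k\<bar>"
      by (simp add: D_def p y w abs_triangle_ineq)
    also have "\<dots> \<le> \<bar>c i j\<bar> * (real i * s ^ (i - 1)) * s ^ j * norm w + \<bar>c i j\<bar> * s ^ i * (real j * s ^ (j - 1)) * norm w"
      unfolding abs_mult power_abs
      by (intro add_mono mult_mono power_mono mult_nonneg_nonneg) (use xz hk s in auto)
    finally show ?thesis by (simp add: B_def p algebra_simps)
  qed
  have "\<exists>g. \<forall>y\<in>S. (\<lambda>n. T (prod_decode n) y) sums g y \<and> (g has_derivative G y) (at y within S)"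
  proof (rule has_derivative_series[OF S(2), where f = "\<lambda>n. T (prod_decode n)" and f' = "\<lambda>n. D (prod_decode n)"])
    show "(x, z) \<in> S" "(\<lambda>n. T (prod_decode n) (x, z)) sums series2 c x z"
      using S(3) Ts[OF S(3)] by auto
    show "(T (prod_decode n) has_derivative D (prod_decode n) y) (at y within S)" if "y \<in> S" for n y
      unfolding T_def D_def case_prod_unfold
      by (rule derivative_eq_intros refl | simp)+ (auto simp: fun_eq_iff algebra_simps)
    show "\<forall>\<^sub>F n in sequentially. \<forall>y\<in>S. \<forall>w. norm ((\<Sum>i<n. D (prod_decode i) y w) - G y w) \<le> e * norm w"
      if "e > 0" for e
    proof -
      have "(\<lambda>n. \<Sum>i. B (prod_decode (i + n))) \<longlonglongrightarrow> 0"
        using suminf_exist_split2[OF Bs] .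
      then have "\<forall>\<^sub>F n in sequentially. (\<Sum>i. B (prod_decode (i + n))) < e"
        using that order_tendstoD(2) by blast
      then show ?thesis
      proof eventually_elim
        case (elim n)
        show ?case
        proof (intro ballI allI)
          fix y w assume y: "y \<in> S"
          let ?d = "\<lambda>i. D (prod_decode i) y w"
          have d: "?d sums G y w" using Ds[of "fst y" "snd y" "fst w" "snd w"] y by simp
          have "G y w - sum ?d {..<n} = (\<Sum>i. ?d (i + n))"
            using suminf_split_initial_segment[OF sums_summable[OF d], of n] sums_unique[OF d] by simp
          also have "norm \<dots> \<le> (\<Sum>i. B (prod_decode (i + n)) * norm w)"
            using Db[OF y] by (intro norm_suminf_le summable_mult2 summable_ignore_initial_segment[OF Bs]) auto
          also have "\<dots> = (\<Sum>i. B (prod_decode (i + n))) * norm w"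
            by (intro suminf_mult2[symmetric] summable_ignore_initial_segment[OF Bs])
          also have "\<dots> \<le> e * norm w" using elim by (intro mult_right_mono) auto
          finally show "norm (sum ?d {..<n} - G y w) \<le> e * norm w" by (simp add: norm_minus_commute)
        qed
      qed
    qed
  qed
  then obtain g where g: "\<And>y. y \<in> S \<Longrightarrow> (\<lambda>n. T (prod_decode n) y) sums g y"
      "\<And>y. y \<in> S \<Longrightarrow> (g has_derivative G y) (at y within S)" by blast
  have eq: "g y = (case y of (x, z) \<Rightarrow> series2 c x z)" if "y \<in> S" for y
    using sums_unique2[OF g(1)[OF that]] Ts[of "fst y" "snd y"] that by (auto simp: case_prod_unfold)
  have "(g has_derivative G (x, z)) (at (x, z))"
    using g(2)[OF S(3)] unfolding at_within_open[OF S(3,1)] .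
  then have "((\<lambda>(x, z). series2 c x z) has_derivative G (x, z)) (at (x, z))"
    by (rule has_derivative_transform_within_open[OF _ S(1,3)]) (simp add: eq)
  then show ?thesis by (simp add: G_def)
qed

lemma series2_chain:
  assumes "geo_bounded r c" "\<bar>f t\<bar> < r / 2" "\<bar>g t\<bar> < r / 2"
    and "(f has_real_derivative f') (at t)" "(g has_real_derivative g') (at t)"
  shows "((\<lambda>t. series2 c (f t) (g t)) has_real_derivative
    (series2 (dX c) (f t) (g t) * f' + series2 (dZ c) (f t) (g t) * g')) (at t)"
proof -
  have "((\<lambda>t. (f t, g t)) has_derivative (\<lambda>h. (f' * h, g' * h))) (at t)"
    using assms(4,5) by (auto intro!: has_derivative_Pair simp: has_field_derivative_def)
  from has_derivative_compose[OF this series2_has_derivative[OF assms(1-3)]]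
  show ?thesis
    unfolding has_field_derivative_def
    by (auto elim!: has_derivative_eq_rhs simp: fun_eq_iff algebra_simps)
qed

lemma geo_bounded_majorized: "majorized M c \<Longrightarrow> geo_bounded 64 c"
proof -
  assume m: "majorized M c"
  have "\<bar>c i j\<bar> \<le> M / 64 ^ (i + j)" for i j
  proof -
    have "M * wt i j \<le> M * (1 / 64 ^ (i + j))"
      using majorized_nonneg[OF m] by (intro mult_left_mono wt_le)
    then show ?thesis using majorizedD[OF m, of i j] by simp
  qed
  then show ?thesis unfolding geo_bounded_def by auto
qed

lemma dX_dZ_commute: "dX (dZ c) = dZ (dX c)"
  by (intro ext) (simp add: dX_def dZ_def)

text \<open>Here \<open>x\<close> stands for the scaled coordinate and \<open>a\<close> for
  \<open>e^2\<close>. On a monomial of degree \<open>d\<close> the bracket acts as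
  \<open>d (d - 1) + 2 d = d (d + 1)\<close>, so both sides have the same coefficients by
  \<open>eq\<close>; the 6 in \<open>\<nu> - 6\<close> is the shift inside
  \<open>eigdiff\<close>.\<close>

lemma series2_equation:
  assumes c: "majorized M c" and x: "\<bar>x\<bar> < 16" and z: "\<bar>z\<bar> < 16"
    and eq: "\<And>i j. a * (real i + 2) * (real i + 1) * c (i + 2) j + (real j + 2) * (real j + 1) * c i (j + 2)
       - eigdiff i j * c i j = \<nu> * c i j + e * cube c i j + (if (i, j) = (0, 1) then 4 else 0)"
  shows "a * series2 (dX (dX c)) x z + series2 (dZ (dZ c)) x z
     - (x\<^sup>2 * series2 (dX (dX c)) x z + 2 * x * z * series2 (dZ (dX c)) x z + z\<^sup>2 * series2 (dZ (dZ c)) x z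
        + 2 * x * series2 (dX c) x z + 2 * z * series2 (dZ c) x z)
     = (\<nu> - 6) * series2 c x z + e * series2 c x z ^ 3 + 4 * z" (is "?L = ?R")
proof -
  define hs where "hs = (\<lambda>c v. ((\<lambda>(i, j). c i j * x ^ i * z ^ j) has_sum v) UNIV)"
  have add: "hs c v \<Longrightarrow> hs d w \<Longrightarrow> hs (\<lambda>i j. c i j + d i j) (v + w)" for c d v w
    unfolding hs_def using has_sum_add by (fastforce simp: case_prod_unfold algebra_simps)
  have cm: "hs c v \<Longrightarrow> hs (\<lambda>i j. t * c i j) (t * v)" for c v t
    unfolding hs_def using has_sum_cmult_right by (fastforce simp: case_prod_unfold algebra_simps)
  have diff: "hs c v \<Longrightarrow> hs d w \<Longrightarrow> hs (\<lambda>i j. c i j - d i j) (v - w)" for c d v w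
    using add[OF _ cm[of d w "-1"]] by auto
  have mx: "hs c v \<Longrightarrow> hs (\<lambda>i j. if i = 0 then 0 else c (i - 1) j) (x * v)"
    and mz: "hs c v \<Longrightarrow> hs (\<lambda>i j. if j = 0 then 0 else c i (j - 1)) (z * v)" for c v
    unfolding hs_def by (rule has_sum_mult_x has_sum_mult_z, assumption)+
  have g: "geo_bounded 64 c" using c by (rule geo_bounded_majorized)
  note g1 = geo_bounded_dX[OF g] geo_bounded_dZ[OF g]
  note g2 = geo_bounded_dX[OF g1(1)] geo_bounded_dZ[OF g1(1)] geo_bounded_dZ[OF g1(2)]
  have S: "hs d (series2 d x z)" if "geo_bounded r d" "r \<ge> 16" for d r
    unfolding hs_def by (rule series2_has_sum[OF that(1)]) (use that x z in auto)
  have s: "hs c (series2 c x z)" "hs (dX c) (series2 (dX c) x z)" "hs (dZ c) (series2 (dZ c) x z)"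
    "hs (dX (dX c)) (series2 (dX (dX c)) x z)" "hs (dZ (dX c)) (series2 (dZ (dX c)) x z)"
    "hs (dZ (dZ c)) (series2 (dZ (dZ c)) x z)"
    by (rule S[OF g] S[OF g1(1)] S[OF g1(2)] S[OF g2(1)] S[OF g2(2)] S[OF g2(3)]; simp)+
  have "series2 (cube c) x z = series2 c x z ^ 3"
    unfolding cube_def
    by (subst series2_conv[OF geo_bounded_majorized[OF majorized_conv[OF c c]] g], use x z in simp, use z in simp)
       (subst series2_conv[OF g g], use x z in \<open>auto simp: power3_eq_cube\<close>)
  with S[OF geo_bounded_majorized[OF majorized_cube[OF c]]]
  have s3: "hs (cube c) (series2 c x z ^ 3)" by simp
  have s1: "hs (\<lambda>i j. if (i, j) = (0, 1) then 1 else 0) z"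
    unfolding hs_def by (rule has_sum_finite_neutralI[of "{(0, 1)}"]) (auto split: if_splits)
  \<comment> \<open>Multiplication by \<open>x\<close> or \<open>z\<close> shifts an index; the
    guarded shifts collapse below to multiples of \<open>c i j\<close> such as
    \<open>i (i - 1) c i j\<close>.\<close>
  have L: "hs (\<lambda>i j. a * dX (dX c) i j + dZ (dZ c) i j -
      ((if i = 0 then 0 else if i - 1 = 0 then 0 else dX (dX c) (i - 1 - 1) j)
       + 2 * (if i = 0 then 0 else if j = 0 then 0 else dZ (dX c) (i - 1) (j - 1))
       + (if j = 0 then 0 else if j - 1 = 0 then 0 else dZ (dZ c) i (j - 1 - 1))
       + 2 * (if i = 0 then 0 else dX c (i - 1) j) + 2 * (if j = 0 then 0 else dZ c i (j - 1))))
     (a * series2 (dX (dX c)) x z + series2 (dZ (dZ c)) x z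
     - (x * (x * series2 (dX (dX c)) x z) + 2 * (x * (z * series2 (dZ (dX c)) x z)) + z * (z * series2 (dZ (dZ c)) x z)
        + 2 * (x * series2 (dX c) x z) + 2 * (z * series2 (dZ c) x z)))"
    by (intro add diff cm mx mz s)
  have R: "hs (\<lambda>i j. (\<nu> - 6) * c i j + e * cube c i j + 4 * (if (i, j) = (0, 1) then 1 else 0)) ?R"
    by (intro add cm s s3 s1)
  have "a * dX (dX c) i j + dZ (dZ c) i j -
      ((if i = 0 then 0 else if i - 1 = 0 then 0 else dX (dX c) (i - 1 - 1) j)
       + 2 * (if i = 0 then 0 else if j = 0 then 0 else dZ (dX c) (i - 1) (j - 1))
       + (if j = 0 then 0 else if j - 1 = 0 then 0 else dZ (dZ c) i (j - 1 - 1))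
       + 2 * (if i = 0 then 0 else dX c (i - 1) j) + 2 * (if j = 0 then 0 else dZ c i (j - 1)))
     = (\<nu> - 6) * c i j + e * cube c i j + 4 * (if (i, j) = (0, 1) then 1 else 0)" for i j
  proof -
    have 1: "(if i = 0 then 0 else if i - 1 = 0 then 0 else dX (dX c) (i - 1 - 1) j) = real i * (real i - 1) * c i j"
      by (cases i; cases "i - 1") (auto simp: dX_def)
    have 2: "(if j = 0 then 0 else if j - 1 = 0 then 0 else dZ (dZ c) i (j - 1 - 1)) = real j * (real j - 1) * c i j"
      by (cases j; cases "j - 1") (auto simp: dZ_def)
    have 3: "(if i = 0 then 0 else if j = 0 then 0 else dZ (dX c) (i - 1) (j - 1)) = real i * real j * c i j"
      by (cases i; cases j) (auto simp: dZ_def dX_def add.commute)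
    have 4: "(if i = 0 then 0 else dX c (i - 1) j) = real i * c i j" "(if j = 0 then 0 else dZ c i (j - 1)) = real j * c i j"
      by (cases i, auto simp: dX_def) (cases j, auto simp: dZ_def)
    have 5: "a * dX (dX c) i j + dZ (dZ c) i j =
       a * (real i + 2) * (real i + 1) * c (i + 2) j + (real j + 2) * (real j + 1) * c i (j + 2)"
      by (simp add: dX_def dZ_def algebra_simps)
    show ?thesis unfolding 1 2 3 4 5 using eq[of i j] by (simp add: eigdiff_def algebra_simps split: if_splits)
  qed
  then have "hs (\<lambda>i j. (\<nu> - 6) * c i j + e * cube c i j + 4 * (if (i, j) = (0, 1) then 1 else 0))
     (a * series2 (dX (dX c)) x z + series2 (dZ (dZ c)) x z
     - (x * (x * series2 (dX (dX c)) x z) + 2 * (x * (z * series2 (dZ (dX c)) x z)) + z * (z * series2 (dZ (dZ c)) x z)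
        + 2 * (x * series2 (dX c) x z) + 2 * (z * series2 (dZ c) x z)))"
    using L by (simp only:)
  from has_sum_unique[OF this[unfolded hs_def] R[unfolded hs_def]]
  show ?thesis by (simp only: power2_eq_square mult.assoc)
qed

section \<open>Recentering and real analyticity\<close>

text \<open>Both binomials are expanded and the terms regrouped by powers of the increments. The
  regrouping is legitimate because the absolute values sum to the series of \<open>|c i j|\<close>
  at \<open>|p| + |h|\<close> and \<open>|q| + |g|\<close>, inside the radius.\<close>

lemma series2_recenter:
  assumes c: "geo_bounded r c" and x: "\<bar>p\<bar> + \<bar>h\<bar> < r" and z: "\<bar>q\<bar> + \<bar>g\<bar> < r"
  shows "((\<lambda>((k, l), (m, n)). c (k + m) (l + n) * (of_nat (k + m choose k) * h ^ k * p ^ m) *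
     (of_nat (l + n choose l) * g ^ l * q ^ n)) has_sum series2 c (p + h) (q + g)) UNIV"
proof -
  let ?A = "Sigma UNIV (\<lambda>(i::nat, j::nat). {..i} \<times> {..j})"
  define T where "T = (\<lambda>c h p g q ((i, j), (k, l)). c i j * (of_nat (i choose k) * h ^ k * p ^ (i - k)) *
     (of_nat (j choose l) * g ^ l * q ^ (j - l)) :: real)"
  have inner: "((\<lambda>y. T c h p g q (x, y)) has_sum (case x of (i, j) \<Rightarrow> c i j * (p + h) ^ i * (q + g) ^ j))
      (case x of (i, j) \<Rightarrow> {..i} \<times> {..j})" for x :: "nat \<times> nat" and c h p g q
  proof -
    obtain i j where x: "x = (i, j)" by (cases x)
    have "c i j * (p + h) ^ i * (q + g) ^ j = (\<Sum>y\<in>{..i} \<times> {..j}. T c h p g q ((i, j), y))"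
      unfolding add.commute[of p h] add.commute[of q g] binomial_ring mult.assoc sum_product
      by (simp add: T_def sum_distrib_left sum.cartesian_product case_prod_unfold mult_ac)
    then show ?thesis by (intro has_sum_finiteI) (auto simp: x)
  qed
  have xz: "\<bar>p + h\<bar> < r" "\<bar>q + g\<bar> < r" using x z by linarith+
  have "T (\<lambda>i j. \<bar>c i j\<bar>) \<bar>h\<bar> \<bar>p\<bar> \<bar>g\<bar> \<bar>q\<bar> summable_on ?A"
    by (rule summable_on_SigmaI[OF inner geo_bounded_terms[OF c]]) (use x z in \<open>auto simp: T_def\<close>)
  then have "(\<lambda>y. norm (T c h p g q y)) summable_on ?A"
    by (simp add: T_def case_prod_unfold abs_mult power_abs)
  then have "T c h p g q summable_on ?A"
    by (rule abs_summable_summable)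
  from has_sum_SigmaI[OF inner series2_has_sum[OF c xz] this]
  have "(T c h p g q has_sum series2 c (p + h) (q + g)) ?A" .
  then show ?thesis
    unfolding has_sum_antidiagonals
    by (rule iffD1[OF has_sum_cong, rotated]) (auto simp: T_def)
qed

text \<open>The function is constant in the second coordinate, so its Taylor coefficients at
  \<open>P\<close> live on exponents with \<open>\<alpha> 2 = 0\<close>. In the unit ball around
  \<open>P\<close> one has \<open>|p| + |h| < 3 < r\<close>, and likewise for \<open>q\<close> and
  \<open>g\<close>.\<close>

lemma real_analytic_series2:
  assumes c: "geo_bounded r c" and r: "r \<ge> 4"
  shows "real_analytic_on (\<lambda>x :: real^3. series2 c (x $ 1) (x $ 3)) {x. \<bar>x $ 1\<bar> < 2 \<and> \<bar>x $ 3\<bar> < 2}"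
  unfolding real_analytic_on_def
proof (intro ballI exI conjI allI)
  fix P :: "real^3" assume P: "P \<in> {x. \<bar>x $ 1\<bar> < 2 \<and> \<bar>x $ 3\<bar> < 2}"
  define p q where "p = P $ 1" and "q = P $ 3"
  have pq: "\<bar>p\<bar> < 2" "\<bar>q\<bar> < 2" using P by (auto simp: p_def q_def)
  let ?c = "\<lambda>(k, l) (m, n). c (k + m) (l + n) * (of_nat (k + m choose k) * p ^ m) * (of_nat (l + n choose l) * q ^ n) :: real"
  define b where "b = (\<lambda>k l. \<Sum>\<^sub>\<infinity>y. ?c (k, l) y)"
  define a where "a = (\<lambda>\<alpha> :: 3 \<Rightarrow> nat. if \<alpha> 2 = 0 then b (\<alpha> 1) (\<alpha> 3) else 0)"
  show "0 < (1::real)" by simp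
  fix x :: "real^3" assume x: "x \<in> ball P 1"
  define h g where "h = x $ 1 - p" and "g = x $ 3 - q"
  have "\<bar>(x - P) $ i\<bar> < 1" for i
    using component_le_norm_cart[of "x - P" i] x by (simp add: dist_norm norm_minus_commute)
  from this[of 1] this[of 3] have hg: "\<bar>h\<bar> < 1" "\<bar>g\<bar> < 1"
    by (auto simp: h_def g_def p_def q_def)
  have sum: "((\<lambda>(y, w). ?c y w * h ^ fst y * g ^ snd y) has_sum series2 c (p + h) (q + g)) (UNIV \<times> UNIV)"
    if "\<bar>h\<bar> < 1" "\<bar>g\<bar> < 1" for h g
  proof -
    have "((\<lambda>((k, l), (m, n)). c (k + m) (l + n) * (of_nat (k + m choose k) * h ^ k * p ^ m) *
        (of_nat (l + n choose l) * g ^ l * q ^ n)) has_sum series2 c (p + h) (q + g)) UNIV"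
      by (rule series2_recenter[OF c]) (use that pq r in auto)
    also have "(\<lambda>((k, l), (m, n)). c (k + m) (l + n) * (of_nat (k + m choose k) * h ^ k * p ^ m) *
        (of_nat (l + n choose l) * g ^ l * q ^ n)) = (\<lambda>(y, w). ?c y w * h ^ fst y * g ^ snd y)"
      by (simp add: fun_eq_iff)
    finally show ?thesis by simp
  qed
  \<comment> \<open>Summability is read off at the increments \<open>1 / 2\<close>, where the
    monomial factor can be divided out; at the given \<open>h\<close> and \<open>g\<close> it may
    vanish.\<close>
  have b: "(?c (k, l) has_sum b k l) UNIV" for k l
  proof -
    have "(\<lambda>(y, w). ?c y w * (1 / 2) ^ fst y * (1 / 2) ^ snd y) summable_on (UNIV \<times> UNIV)"
      by (rule has_sum_imp_summable[OF sum]) auto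
    from summable_on_SigmaD1[OF this, of "(k, l)"]
    have "(\<lambda>w. ?c (k, l) w * ((1 / 2) ^ k * (1 / 2) ^ l)) summable_on UNIV" by (simp add: mult.assoc)
    from summable_on_cmult_left[OF this, of "2 ^ k * 2 ^ l"]
    have "?c (k, l) summable_on UNIV" by (simp add: power_one_over)
    then show ?thesis unfolding b_def by (rule has_sum_infsum)
  qed
  have 1: "((\<lambda>(k, l). b k l * h ^ k * g ^ l) has_sum series2 c (p + h) (q + g)) UNIV"
  proof (rule has_sum_SigmaD[OF sum[OF hg]])
    fix y :: "nat \<times> nat"
    show "((\<lambda>w. case (y, w) of (y, w) \<Rightarrow> ?c y w * h ^ fst y * g ^ snd y) has_sum
        (case y of (k, l) \<Rightarrow> b k l * h ^ k * g ^ l)) UNIV"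
      using has_sum_cmult_left[OF b[of "fst y" "snd y"], of "h ^ fst y * g ^ snd y"]
      by (simp add: case_prod_unfold mult.assoc)
  qed
  have 2: "series2 c (p + h) (q + g) = series2 c (x $ 1) (x $ 3)"
    by (simp add: h_def g_def)
  have "((\<lambda>(k, l). b k l * h ^ k * g ^ l) has_sum series2 c (x $ 1) (x $ 3)) UNIV \<longleftrightarrow>
    ((\<lambda>\<alpha>. a \<alpha> * (\<Prod>i\<in>UNIV. (x $ i - P $ i) ^ \<alpha> i)) has_sum series2 c (x $ 1) (x $ 3)) {\<alpha>. \<alpha> 2 = 0}"
  proof (rule has_sum_reindex_bij_witness[of _ "\<lambda>\<alpha>. (\<alpha> 1, \<alpha> 3)" "\<lambda>(k, l) i. if i = 1 then k else if i = 3 then l else 0"])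
    fix \<alpha> :: "3 \<Rightarrow> nat" assume "\<alpha> \<in> {\<alpha>. \<alpha> 2 = 0}"
    then show "(case (\<alpha> 1, \<alpha> 3) of (k, l) \<Rightarrow> \<lambda>i :: 3. if i = 1 then k else if i = 3 then l else 0) = \<alpha>"
      using exhaust_3 by (intro ext) (simp, metis)
  next
    fix y :: "nat \<times> nat"
    let ?\<alpha> = "case y of (k, l) \<Rightarrow> \<lambda>i :: 3. if i = 1 then k else if i = 3 then l else 0"
    have "?\<alpha> 1 = fst y" "?\<alpha> 2 = 0" "?\<alpha> 3 = snd y" by (auto simp: case_prod_unfold)
    then show "a ?\<alpha> * (\<Prod>i\<in>UNIV. (x $ i - P $ i) ^ ?\<alpha> i) = (case y of (k, l) \<Rightarrow> b k l * h ^ k * g ^ l)"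
      unfolding UNIV_3 by (simp add: a_def h_def g_def p_def q_def case_prod_unfold)
  qed auto
  with 1 2 have 3: "((\<lambda>\<alpha>. a \<alpha> * (\<Prod>i\<in>UNIV. (x $ i - P $ i) ^ \<alpha> i)) has_sum series2 c (x $ 1) (x $ 3)) {\<alpha>. \<alpha> 2 = 0}"
    by simp
  show "((\<lambda>\<alpha>. a \<alpha> * (\<Prod>i\<in>UNIV. (x $ i - P $ i) ^ \<alpha> i)) has_sum series2 c (x $ 1) (x $ 3)) UNIV"
    by (rule iffD1[OF has_sum_cong_neutral 3]) (auto simp: a_def)
qed

lemma series2_scale: "series2 c (e * x) z = series2 (\<lambda>i j. c i j * e ^ i) x z"
  by (simp add: series2_def power_mult_distrib mult_ac)

lemma geo_bounded_scale:
  assumes "geo_bounded r c" "\<bar>e\<bar> \<le> 1"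
  shows "geo_bounded r (\<lambda>i j. c i j * e ^ i)"
proof -
  have "\<bar>c i j * e ^ i\<bar> \<le> \<bar>c i j\<bar>" for i j
    using mult_left_mono[of "\<bar>e\<bar> ^ i" 1 "\<bar>c i j\<bar>"] assms(2) by (simp add: abs_mult power_abs power_le_one)
  then show ?thesis using assms(1) unfolding geo_bounded_def by (meson order_trans)
qed

lemma geo_bounded_cmult:
  assumes "geo_bounded r c"
  shows "geo_bounded r (\<lambda>i j. t * c i j)"
proof -
  obtain M where "r > 0" "\<And>i j. \<bar>c i j\<bar> \<le> M / r ^ (i + j)"
    using assms unfolding geo_bounded_def by auto
  then have "\<bar>t * c i j\<bar> \<le> (\<bar>t\<bar> * M) / r ^ (i + j)" for i j
    using mult_left_mono[of "\<bar>c i j\<bar>" "M / r ^ (i + j)" "\<bar>t\<bar>"] by (simp add: abs_mult)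
  then show ?thesis using \<open>r > 0\<close> unfolding geo_bounded_def by blast
qed

lemma series2_cmult: "series2 (\<lambda>i j. t * c i j) x z = t * series2 c x z"
  by (simp add: series2_def infsum_cmult_right' case_prod_unfold flip: mult.assoc)
     (simp add: mult.assoc infsum_cmult_right')

lemma analytic_on_sphere_series2:
  assumes c: "geo_bounded r c" and "r \<ge> 4"
  shows "analytic_on_sphere (\<lambda>x. series2 c (x $ 1) (x $ 3))"
  unfolding analytic_on_sphere_def
proof (intro exI conjI)
  let ?U = "{x :: real^3. \<bar>x $ 1\<bar> < 2 \<and> \<bar>x $ 3\<bar> < 2}"
  show "open ?U"
    by (intro open_Collect_conj open_Collect_less continuous_intros)
  show "sphere 0 1 \<subseteq> ?U"
  proof
    fix x :: "real^3" assume "x \<in> sphere 0 1"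
    then show "x \<in> ?U" using component_le_norm_cart[of x 1] component_le_norm_cart[of x 3] by auto
  qed
  show "real_analytic_on (\<lambda>x. series2 c (x $ 1) (x $ 3)) ?U"
    by (rule real_analytic_series2[OF assms])
qed auto

subsection \<open>Spherical harmonics: orthogonality and size\<close>

text \<open>\<open>cos p ^ i\<close> contains only frequencies up to \<open>i\<close> of the parity
  of \<open>i\<close>. The induction uses the product formula for \<open>cos p cos (k p)\<close> and
  its sine analogue; \<open>k\<close> is an integer because \<open>k - 1\<close> may become
  negative.\<close>

lemma has_integral_cos_power_trig:
  assumes "int i < \<bar>k\<bar> \<or> odd (int i + k)"
  shows "((\<lambda>p. cos p ^ i * cos (of_int k * p)) has_integral 0) {0..2 * pi}"
    and "((\<lambda>p. cos p ^ i * sin (of_int k * p)) has_integral 0) {0..2 * pi}"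
proof -
  have "((\<lambda>p. cos p ^ i * cos (of_int k * p)) has_integral 0) {0..2 * pi} \<and>
    ((\<lambda>p. cos p ^ i * sin (of_int k * p)) has_integral 0) {0..2 * pi}"
    using assms
  proof (induction i arbitrary: k)
    case 0
    then have k: "k \<noteq> 0" by auto
    have e: "cos (of_int k * (2 * pi)) = 1" "sin (of_int k * (2 * pi)) = 0"
      using cos_int_2pin[of k] sin_int_2pin[of k] by (simp_all add: mult_ac)
    have "((\<lambda>p. cos (of_int k * p)) has_integral
        (sin (of_int k * (2 * pi)) / of_int k - sin (of_int k * 0) / of_int k)) {0..2 * pi}"
      by (rule fundamental_theorem_of_calculus)
         (use k in \<open>auto intro!: derivative_eq_intros simp flip: has_real_derivative_iff_has_vector_derivative\<close>)
    moreover have "((\<lambda>p. sin (of_int k * p)) has_integral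
        (- cos (of_int k * (2 * pi)) / of_int k - - cos (of_int k * 0) / of_int k)) {0..2 * pi}"
      by (rule fundamental_theorem_of_calculus)
         (use k in \<open>auto intro!: derivative_eq_intros simp flip: has_real_derivative_iff_has_vector_derivative\<close>)
    ultimately show ?case by (simp add: e)
  next
    case (Suc i)
    have c: "cos p ^ Suc i * cos (of_int k * p) =
        1 / 2 * (cos p ^ i * cos (of_int (k + 1) * p) + cos p ^ i * cos (of_int (k - 1) * p))"
      and s: "cos p ^ Suc i * sin (of_int k * p) =
        1 / 2 * (cos p ^ i * sin (of_int (k + 1) * p) + cos p ^ i * sin (of_int (k - 1) * p))" for p :: real
      by (simp_all add: cos_add sin_add cos_diff sin_diff algebra_simps)
    have P: "int i < \<bar>k + 1\<bar> \<or> odd (int i + (k + 1))" "int i < \<bar>k - 1\<bar> \<or> odd (int i + (k - 1))"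
      using Suc.prems by auto
    note I = Suc.IH[OF P(1)] Suc.IH[OF P(2)]
    show ?case
      unfolding c s
      using has_integral_mult_right[OF has_integral_add[OF conjunct1[OF I(1)] conjunct1[OF I(2)]], of "1 / 2"]
        has_integral_mult_right[OF has_integral_add[OF conjunct2[OF I(1)] conjunct2[OF I(2)]], of "1 / 2"]
      by simp
  qed
  then show "((\<lambda>p. cos p ^ i * cos (of_int k * p)) has_integral 0) {0..2 * pi}"
    "((\<lambda>p. cos p ^ i * sin (of_int k * p)) has_integral 0) {0..2 * pi}" by auto
qed

section \<open>Legendre polynomials and associated Legendre functions\<close>

text \<open>Each derivative lowers the multiplicity of a factor by at most one; truncated
  subtraction makes the claim trivial for \<open>s >= m\<close>.\<close>

lemma power_dvd_funpow_pderiv: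
  fixes p q :: "real poly"
  assumes "p ^ m dvd q"
  shows "p ^ (m - s) dvd (pderiv ^^ s) q"
proof (induction s)
  case 0
  then show ?case using assms by simp
next
  case (Suc s)
  have *: "p ^ (a - 1) dvd pderiv q" if "p ^ a dvd q" for a and q :: "real poly"
  proof (cases a)
    case (Suc b)
    obtain r where "q = p ^ a * r" using \<open>p ^ a dvd q\<close> by (elim dvdE)
    then have "pderiv q = p ^ Suc b * pderiv r + r * (smult (of_nat (Suc b)) (p ^ b) * pderiv p)"
      by (simp only: Suc pderiv_mult pderiv_power_Suc)
    also have "\<dots> = p ^ b * (p * pderiv r + smult (of_nat (Suc b)) (pderiv p) * r)"
      by (simp add: algebra_simps)
    finally have "p ^ b dvd pderiv q" by simp
    then show ?thesis by (simp add: Suc)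
  qed simp
  from *[OF Suc] show ?case by simp
qed

lemma funpow_pderiv_eq_0: "degree p < n \<Longrightarrow> (pderiv ^^ n) p = 0" for p :: "real poly"
proof (induction n arbitrary: p)
  case (Suc n)
  show ?case
  proof (cases "degree p = 0")
    case True
    then have "pderiv p = 0" by (simp add: pderiv_eq_0_iff)
    moreover have "(pderiv ^^ m) (0 :: real poly) = 0" for m by (induction m) auto
    ultimately show ?thesis by (simp add: funpow_Suc_right del: funpow.simps)
  next
    case False
    then show ?thesis using Suc by (simp add: funpow_Suc_right degree_pderiv del: funpow.simps)
  qed
qed simp

text \<open>The boundary terms of \<open>N\<close> integrations by parts, assembled into one
  antiderivative: the alternating sum telescopes under \<open>pderiv\<close>.\<close>

lemma pderiv_iterated_by_parts:
  fixes R F :: "real poly"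
  shows "pderiv (\<Sum>s<N. (- 1) ^ s * (pderiv ^^ s) R * (pderiv ^^ (N - 1 - s)) F) =
    R * (pderiv ^^ N) F - (- 1) ^ N * (pderiv ^^ N) R * F"
proof -
  define a where "a = (\<lambda>s. (- 1) ^ s * (pderiv ^^ s) R * (pderiv ^^ (N - s)) F)"
  have m1: "pderiv ((- 1) ^ s) = (0 :: real poly)" for s
    by (induction s) (auto simp: pderiv_mult pderiv_minus)
  have "pderiv ((- 1) ^ s * (pderiv ^^ s) R * (pderiv ^^ (N - 1 - s)) F) = a s - a (Suc s)" if "s < N" for s
  proof -
    have "N - s = Suc (N - 1 - s)" using that by auto
    then show ?thesis by (simp add: a_def pderiv_mult m1)
  qed
  then have "pderiv (\<Sum>s<N. (- 1) ^ s * (pderiv ^^ s) R * (pderiv ^^ (N - 1 - s)) F) = (\<Sum>s<N. a s - a (Suc s))"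
    by (simp add: higher_pderiv_sum[of 1, simplified])
  also have "\<dots> = a 0 - a N" by (rule sum_lessThan_telescope')
  finally show ?thesis by (simp add: a_def)
qed

lemma funpow_pderiv_legendre:
  "(pderiv ^^ k) (legendre_poly n) = smult (1 / (2 ^ n * fact n)) ((pderiv ^^ (n + k)) ([:-1, 0, 1:] ^ n))"
proof -
  have "(pderiv ^^ k) (smult a p) = smult a ((pderiv ^^ k) p)" for a :: real and p
    by (induction k) (auto simp: pderiv_smult)
  then show ?thesis
    by (simp add: legendre_poly_def add.commute[of n k] funpow_add)
qed

text \<open>In the variable \<open>cos t\<close> and by the formula of Rodrigues, the integrand is a
  multiple of \<open>R\<close> times the derivative of order \<open>N = n + k\<close> of
  \<open>F\<close>. Since \<open>R\<close> has degree at most \<open>i + k + j < N\<close>,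
  integrating by parts \<open>N\<close> times leaves only boundary terms, and these vanish. The last
  factor \<open>sin t\<close> comes from the substitution.\<close>

lemma has_integral_legendre_orthogonal:
  assumes "even (i + k)" "k \<le> i" "i + j < n"
  shows "((\<lambda>t. sin t ^ i * cos t ^ j * (sin t ^ k * poly ((pderiv ^^ k) (legendre_poly n)) (cos t)) * sin t)
    has_integral 0) {0..pi}"
proof -
  define q where "q = (i + k) div 2"
  have q: "i + k = 2 * q" "k \<le> q" using assms by (auto simp: q_def)
  define R :: "real poly" where "R = [:1, 0, -1:] ^ q * [:0, 1:] ^ j"
  define F :: "real poly" where "F = [:-1, 0, 1:] ^ n"
  define N where "N = n + k"
  define G where "G = (\<Sum>s<N. (- 1) ^ s * (pderiv ^^ s) R * (pderiv ^^ (N - 1 - s)) F)"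
  have "degree ([:1, 0, -1:] ^ q :: real poly) \<le> 2 * q" "degree ([:0, 1:] ^ j :: real poly) \<le> 1 * j"
    by (rule order_trans[OF degree_power_le], simp)+
  then have "degree R \<le> 2 * q + j"
    unfolding R_def by (intro order_trans[OF degree_mult_le]) simp
  then have "(pderiv ^^ N) R = 0"
    using assms q by (intro funpow_pderiv_eq_0) (simp add: N_def)
  then have G': "pderiv G = R * (pderiv ^^ N) F"
    unfolding G_def pderiv_iterated_by_parts by simp
  have G0: "poly G x = 0" if x: "x\<^sup>2 = 1" for x
    unfolding G_def poly_sum
  proof (intro sum.neutral ballI)
    fix s assume s: "s \<in> {..<N}"
    show "poly ((- 1) ^ s * (pderiv ^^ s) R * (pderiv ^^ (N - 1 - s)) F) x = 0"
    \<comment> \<open>For \<open>s < k <= q\<close> the derivative of \<open>R\<close> still has a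
      factor \<open>1 - t^2\<close>; for \<open>s >= k\<close> fewer than \<open>n\<close>
      derivatives fall on \<open>F\<close>, whose zeros at 1 and -1 have order
      \<open>n\<close>.\<close>
    proof (cases "s < k")
      case True
      have "[:1, 0, -1:] ^ (q - s) dvd (pderiv ^^ s) R"
        by (rule power_dvd_funpow_pderiv) (simp add: R_def)
      moreover have "[:1, 0, -1:] dvd [:1, 0, -1 :: real:] ^ (q - s)"
        using True q by (intro dvd_power) auto
      ultimately have "[:1, 0, -1:] dvd (pderiv ^^ s) R" using dvd_trans by blast
      then have "poly ((pderiv ^^ s) R) x = 0" using x by (auto elim!: dvdE simp: power2_eq_square)
      then show ?thesis by simp
    next
      case False
      have "[:-1, 0, 1:] ^ (n - (N - 1 - s)) dvd (pderiv ^^ (N - 1 - s)) F"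
        by (rule power_dvd_funpow_pderiv) (simp add: F_def)
      moreover have "[:-1, 0, 1:] dvd [:-1, 0, 1 :: real:] ^ (n - (N - 1 - s))"
        using False s assms by (intro dvd_power) (auto simp: N_def)
      ultimately have "[:-1, 0, 1:] dvd (pderiv ^^ (N - 1 - s)) F" using dvd_trans by blast
      then have "poly ((pderiv ^^ (N - 1 - s)) F) x = 0" using x by (auto elim!: dvdE simp: power2_eq_square)
      then show ?thesis by simp
    qed
  qed
  have "((\<lambda>t. poly (R * (pderiv ^^ N) F) (cos t) * sin t) has_integral (- poly G (cos pi) - - poly G (cos 0))) {0..pi}"
    by (rule fundamental_theorem_of_calculus)
       (auto intro!: derivative_eq_intros poly_DERIV[THEN DERIV_chain2] simp: G'
         simp flip: has_real_derivative_iff_has_vector_derivative)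
  then have "((\<lambda>t. poly (R * (pderiv ^^ N) F) (cos t) * sin t) has_integral 0) {0..pi}"
    by (simp add: G0)
  from has_integral_mult_right[OF this, of "1 / (2 ^ n * fact n)"]
  have "((\<lambda>t. 1 / (2 ^ n * fact n) * (poly (R * (pderiv ^^ N) F) (cos t) * sin t)) has_integral 0) {0..pi}" by simp
  moreover have "1 / (2 ^ n * fact n) * (poly (R * (pderiv ^^ N) F) (cos t) * sin t) =
      sin t ^ i * cos t ^ j * (sin t ^ k * poly ((pderiv ^^ k) (legendre_poly n)) (cos t)) * sin t" for t
  proof -
    have "1 - cos t * cos t = (sin t)\<^sup>2" unfolding sin_squared_eq by (simp add: power2_eq_square)
    then have "poly R (cos t) = ((sin t)\<^sup>2) ^ q * cos t ^ j" by (simp add: R_def poly_power)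
    also have "((sin t)\<^sup>2) ^ q = sin t ^ i * sin t ^ k"
      by (simp flip: power_mult power_add q(1))
    finally show ?thesis
      by (simp add: funpow_pderiv_legendre F_def N_def)
  qed
  ultimately show ?thesis by simp
qed

text \<open>The sum of the absolute values of the coefficients bounds a polynomial on the unit interval,
  at most doubles under multiplication by \<open>x\<^sup>2 - 1\<close> and grows at most by the degree under
  differentiation.\<close>

lemma funpow_pderiv_legendre_bound:
  assumes "k \<le> n" "\<bar>t\<bar> \<le> 1"
  shows "\<bar>poly ((pderiv ^^ k) (legendre_poly n)) t\<bar> \<le> fact (2 * n) / (fact n * fact (n - k))"
proof -
  define L where "L = (\<lambda>d C (p :: real poly). degree p \<le> d \<and> (\<Sum>i\<le>d. \<bar>coeff p i\<bar>) \<le> C)"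
  have Q: "L (Suc (Suc d)) (2 * C) ([:-1, 0, 1:] * p)" if "L d C p" for d C p
  proof -
    have c: "coeff ([:-1, 0, 1:] * p) i = (case i of Suc (Suc l) \<Rightarrow> coeff p l | _ \<Rightarrow> 0) - coeff p i" for i
      by (simp add: coeff_pCons split: nat.splits)
    have "(\<Sum>i\<le>Suc (Suc d). \<bar>coeff ([:-1, 0, 1:] * p) i\<bar>)
        \<le> (\<Sum>i\<le>Suc (Suc d). \<bar>case i of Suc (Suc l) \<Rightarrow> coeff p l | _ \<Rightarrow> 0\<bar> + \<bar>coeff p i\<bar>)"
      unfolding c by (intro sum_mono abs_triangle_ineq4)
    also have "\<dots> = (\<Sum>i\<le>d. \<bar>coeff p i\<bar>) + (\<Sum>i\<le>Suc (Suc d). \<bar>coeff p i\<bar>)"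
      unfolding sum.distrib by (simp add: sum.atMost_Suc_shift[of _ "Suc d"] sum.atMost_Suc_shift[of _ d] del: sum.atMost_Suc)
    also have "(\<Sum>i\<le>Suc (Suc d). \<bar>coeff p i\<bar>) = (\<Sum>i\<le>d. \<bar>coeff p i\<bar>)"
      using that by (simp add: L_def coeff_eq_0)
    finally have "(\<Sum>i\<le>Suc (Suc d). \<bar>coeff ([:-1, 0, 1:] * p) i\<bar>) \<le> 2 * C" using that by (simp add: L_def)
    moreover have "degree ([:-1, 0, 1:] * p) \<le> 2 + d"
      using that by (intro order_trans[OF degree_mult_le] add_mono) (auto simp: L_def)
    ultimately show ?thesis by (simp add: L_def)
  qed
  have F: "L (2 * n) (2 ^ n) ([:-1, 0, 1:] ^ n)" for n
  proof (induction n)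
    case (Suc n)
    show ?case using Q[OF Suc] by simp
  qed (simp add: L_def)
  have D: "L (d - 1) (d * C) (pderiv p)" if "L d C p" "0 < d" for d :: nat and C :: real and p
  proof -
    have d: "d = Suc (d - 1)" using that by simp
    have "(\<Sum>i\<le>d - 1. \<bar>coeff (pderiv p) i\<bar>) \<le> (\<Sum>i\<le>d - 1. real d * \<bar>coeff p (Suc i)\<bar>)"
      by (intro sum_mono) (use that in \<open>auto simp: coeff_pderiv abs_mult intro!: mult_right_mono\<close>)
    also have "\<dots> \<le> real d * (\<Sum>i\<le>d. \<bar>coeff p i\<bar>)"
      by (subst (2) d, subst sum.atMost_Suc_shift) (simp add: sum_distrib_left algebra_simps)
    also have "\<dots> \<le> real d * C" using that by (intro mult_left_mono) (auto simp: L_def)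
    finally show ?thesis using that by (simp add: L_def degree_pderiv diff_le_mono)
  qed
  \<comment> \<open>Successive derivatives cost \<open>2 n\<close>, \<open>2 n - 1\<close> and so
    on, which multiply to the quotient of factorials; \<open>2 ^ n\<close> comes from the
    \<open>n\<close> factors \<open>x^2 - 1\<close>.\<close>
  have m: "L (2 * n - m) (2 ^ n * (fact (2 * n) / fact (2 * n - m))) ((pderiv ^^ m) ([:-1, 0, 1:] ^ n))"
    if "m \<le> 2 * n" for m
    using that
  proof (induction m)
    case 0
    show ?case using F by simp
  next
    case (Suc m)
    have f: "fact (2 * n - m) = real (2 * n - m) * fact (2 * n - Suc m)"
      using Suc.prems by (subst fact_reduce) auto
    have "real (2 * n - m) * (2 ^ n * (fact (2 * n) / fact (2 * n - m))) = 2 ^ n * (fact (2 * n) / fact (2 * n - Suc m))"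
      unfolding f using Suc.prems by (simp del: of_nat_diff)
    then show ?case using D[OF Suc.IH] Suc.prems by simp
  qed
  have B: "\<bar>poly p t\<bar> \<le> C" if "L d C p" for d C p
  proof -
    have "poly p t = (\<Sum>i\<le>d. coeff p i * t ^ i)"
      unfolding poly_altdef using that
      by (intro sum.mono_neutral_left) (auto simp: L_def coeff_eq_0)
    also have "\<bar>\<dots>\<bar> \<le> (\<Sum>i\<le>d. \<bar>coeff p i\<bar> * 1)"
      by (intro order_trans[OF sum_abs] sum_mono)
         (unfold abs_mult power_abs, intro mult_left_mono power_le_one, use assms(2) in auto)
    finally show ?thesis using that by (simp add: L_def)
  qed
  have "\<bar>poly ((pderiv ^^ (n + k)) ([:-1, 0, 1:] ^ n)) t\<bar> \<le> 2 ^ n * (fact (2 * n) / fact (2 * n - (n + k)))"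
    by (rule B[OF m]) (use assms in simp)
  then have "1 / (2 ^ n * fact n) * \<bar>poly ((pderiv ^^ (n + k)) ([:-1, 0, 1:] ^ n)) t\<bar>
      \<le> 1 / (2 ^ n * fact n) * (2 ^ n * (fact (2 * n) / fact (n - k)))"
    by (intro mult_left_mono) auto
  then show ?thesis by (simp add: funpow_pderiv_legendre abs_mult)
qed

text \<open>After squaring, the normalising constant and the Legendre bound combine to
  \<open>(2 n + 1) / (2 pi)\<close> times the binomial coefficients \<open>2 * n choose n\<close>
  and \<open>2 * n choose (n + k)\<close>. Each of the three factors is at most \<open>4^n\<close>,
  and \<open>64^n\<close> is the square of \<open>8^n\<close>.\<close>

lemma sph_harm_bound:
  assumes "\<bar>m\<bar> \<le> int n" "0 \<le> \<theta>" "\<theta> \<le> pi"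
  shows "\<bar>sph_harm n m (sph_pt \<theta> \<phi>)\<bar> \<le> 8 ^ n"
proof -
  define k where "k = nat \<bar>m\<bar>"
  have k: "k \<le> n" using assms by (simp add: k_def)
  define A B C D :: real where "A = fact (n - k)" and "B = fact (n + k)" and "C = fact n" and "D = fact (2 * n)"
  have pos: "A > 0" "B > 0" "C > 0" "D > 0" by (auto simp: A_def B_def C_def D_def)
  let ?t = "if m = 0 then 1 else if m > 0 then sqrt 2 * cos (real_of_int \<bar>m\<bar> * \<phi>) else sqrt 2 * sin (real_of_int \<bar>m\<bar> * \<phi>)"
  have t: "\<bar>?t\<bar> \<le> sqrt 2" by (auto simp: abs_mult)
  have s: "\<bar>sqrt (1 - (cos \<theta>)\<^sup>2) ^ k\<bar> \<le> 1"
    by (simp add: power_abs power_le_one sin_squared_eq[symmetric])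
  have P: "\<bar>poly ((pderiv ^^ k) (legendre_poly n)) (cos \<theta>)\<bar> \<le> D / (C * A)"
    unfolding A_def C_def D_def by (rule funpow_pderiv_legendre_bound[OF k]) simp
  have "\<bar>sph_harm n m (sph_pt \<theta> \<phi>)\<bar> = \<bar>sph_harm_const n k\<bar> *
      (\<bar>sqrt (1 - (cos \<theta>)\<^sup>2) ^ k\<bar> * \<bar>poly ((pderiv ^^ k) (legendre_poly n)) (cos \<theta>)\<bar>) * \<bar>?t\<bar>"
    unfolding sph_harm_sph_pt[OF assms(2,3)] assoc_legendre_def k_def by (simp add: abs_mult)
  also have "\<dots> \<le> \<bar>sph_harm_const n k\<bar> * (1 * (D / (C * A))) * sqrt 2"
    by (intro mult_mono mult_left_mono s P t) (use pos in auto)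
  also have "\<dots> \<le> 8 ^ n"
  proof (rule power2_le_imp_le)
    have b1: "D / (C * C) \<le> 4 ^ n" "D / (A * B) \<le> 4 ^ n"
    proof -
      have "2 * n choose l \<le> 4 ^ n" for l
        using binomial_le_pow2[of "2 * n" l] by (simp add: power_mult)
      then have "real (2 * n choose l) \<le> real (4 ^ n)" for l
        by (rule of_nat_mono)
      then have "real (2 * n choose l) \<le> 4 ^ n" for l
        by (metis of_nat_numeral of_nat_power)
      moreover have "D / (C * C) = real (2 * n choose n)" "D / (A * B) = real (2 * n choose (n + k))"
        using binomial_fact[of n "2 * n", where 'a = real] binomial_fact[of "n + k" "2 * n", where 'a = real] k
        by (simp_all add: A_def B_def C_def D_def mult.commute)
      ultimately show "D / (C * C) \<le> 4 ^ n" "D / (A * B) \<le> 4 ^ n" by simp_all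
    qed
    have n4: "2 * real n + 1 \<le> 4 ^ n"
      by (induction n) auto
    have "(\<bar>sph_harm_const n k\<bar> * (1 * (D / (C * A))) * sqrt 2)\<^sup>2
        = ((2 * real n + 1) / (2 * pi)) * ((D / (C * C)) * (D / (A * B)))"
    proof -
      have "(sph_harm_const n k)\<^sup>2 = (2 * real n + 1) / (4 * pi) * (A / B)"
        unfolding sph_harm_const_def A_def B_def by simp
      then have "(\<bar>sph_harm_const n k\<bar> * (1 * (D / (C * A))) * sqrt 2)\<^sup>2 =
          (2 * real n + 1) / (4 * pi) * (A / B) * (D / (C * A))\<^sup>2 * 2"
        by (simp only: power_mult_distrib power2_abs mult_1) simp
      also have "\<dots> = ((2 * real n + 1) / (2 * pi)) * ((D / (C * C)) * (D / (A * B)))"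
        using pos by (simp add: power2_eq_square field_simps)
      finally show ?thesis .
    qed
    also have "\<dots> \<le> (4 ^ n / 1) * (4 ^ n * 4 ^ n)"
      by (intro mult_mono frac_le b1 n4) (use pos pi_ge_two in auto)
    also have "\<dots> = (8 ^ n)\<^sup>2"
      by (simp flip: power_mult_distrib power_mult) (simp add: power_mult mult.commute[of n 2] flip: power_mult_distrib)
    finally show "(\<bar>sph_harm_const n k\<bar> * (1 * (D / (C * A))) * sqrt 2)\<^sup>2 \<le> (8 ^ n)\<^sup>2" .
  qed simp
  finally show ?thesis .
qed

lemma continuous_sph_harm: "continuous_on ({0..pi} \<times> {0..2 * pi}) (\<lambda>(\<theta>, \<phi>). sph_harm n m (sph_pt \<theta> \<phi>))"
  unfolding sph_harm_def Let_def sph_pt_def case_prod_unfold vector_3 Complex_eq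
  by (cases "m = 0"; cases "m > 0"; simp only: if_True if_False simp_thms) (intro continuous_intros)+

text \<open>The variables separate. If \<open>k = |m|\<close> satisfies \<open>k <= i\<close> and
  \<open>i + k\<close> is even, the colatitude integral vanishes; otherwise the longitude integral
  does.\<close>

lemma sph_harm_monomial_orthogonal:
  assumes "i + j < n"
  shows "integral ({0..pi} \<times> {0..2 * pi}) (\<lambda>(\<theta>, \<phi>). (sin \<theta> * cos \<phi>) ^ i * cos \<theta> ^ j *
     sph_harm n m (sph_pt \<theta> \<phi>) * sin \<theta>) = 0"
proof -
  define k where "k = nat \<bar>m\<bar>"
  define T where "T = (\<lambda>\<phi>. if m = 0 then 1 else if m > 0 then sqrt 2 * cos (real_of_int \<bar>m\<bar> * \<phi>) else sqrt 2 * sin (real_of_int \<bar>m\<bar> * \<phi>))"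
  define H where "H = (\<lambda>t. sin t ^ i * cos t ^ j * (sin t ^ k * poly ((pderiv ^^ k) (legendre_poly n)) (cos t)) * sin t)"
  have cb: "{0..pi} \<times> {0..2 * pi} = cbox (0, 0) (pi, 2 * pi)" by (simp add: cbox_Pair_eq)
  have eq: "(sin \<theta> * cos \<phi>) ^ i * cos \<theta> ^ j * sph_harm n m (sph_pt \<theta> \<phi>) * sin \<theta> =
     sph_harm_const n k * (H \<theta> * (cos \<phi> ^ i * T \<phi>))" if "0 \<le> \<theta>" "\<theta> \<le> pi" for \<theta> \<phi>
  proof -
    have "sqrt (1 - (cos \<theta>)\<^sup>2) = sin \<theta>"
      using sin_ge_zero[OF that] by (simp add: sin_squared_eq[symmetric])
    then show ?thesis
      unfolding sph_harm_sph_pt[OF that] assoc_legendre_def k_def[symmetric] H_def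
      by (simp add: T_def power_mult_distrib mult_ac)
  qed
  have "integral ({0..pi} \<times> {0..2 * pi}) (\<lambda>(\<theta>, \<phi>). (sin \<theta> * cos \<phi>) ^ i * cos \<theta> ^ j *
     sph_harm n m (sph_pt \<theta> \<phi>) * sin \<theta>) =
     integral (cbox (0, 0) (pi, 2 * pi)) (\<lambda>(\<theta>, \<phi>). sph_harm_const n k * (H \<theta> * (cos \<phi> ^ i * T \<phi>)))"
    unfolding cb[symmetric] by (rule integral_cong) (auto simp: eq)
  also have "\<dots> = integral (cbox 0 pi) (\<lambda>\<theta>. integral (cbox 0 (2 * pi)) (\<lambda>\<phi>. sph_harm_const n k * (H \<theta> * (cos \<phi> ^ i * T \<phi>))))"
  proof (subst integral_prod_continuous)
    have "continuous_on UNIV T"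
      unfolding T_def by (cases "m = 0"; cases "m > 0"; simp) (intro continuous_intros)+
    then have "continuous_on A (\<lambda>x. T (snd x))" for A :: "(real \<times> real) set"
      by (rule continuous_on_compose2) (auto intro!: continuous_intros)
    then show "continuous_on (cbox (0, 0) (pi, 2 * pi)) (\<lambda>(\<theta>, \<phi>). sph_harm_const n k * (H \<theta> * (cos \<phi> ^ i * T \<phi>)))"
      unfolding case_prod_unfold H_def by (intro continuous_intros)
  qed simp
  also have "\<dots> = sph_harm_const n k * (integral {0..pi} H * integral {0..2 * pi} (\<lambda>\<phi>. cos \<phi> ^ i * T \<phi>))"
    by simp
  also have "integral {0..pi} H * integral {0..2 * pi} (\<lambda>\<phi>. cos \<phi> ^ i * T \<phi>) = 0"
  proof (cases "even (i + k) \<and> k \<le> i")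
    case True
    then have "integral {0..pi} H = 0"
      unfolding H_def using has_integral_legendre_orthogonal[of i k j n] assms by (auto intro!: integral_unique)
    then show ?thesis by simp
  next
    case False
    then have P: "int i < \<bar>int k\<bar> \<or> odd (int i + int k)" by auto
    have "((\<lambda>\<phi>. cos \<phi> ^ i * T \<phi>) has_integral 0) {0..2 * pi}"
      using has_integral_mult_right[OF has_integral_cos_power_trig(1)[OF P], of "sqrt 2"]
        has_integral_mult_right[OF has_integral_cos_power_trig(2)[OF P], of "sqrt 2"]
        has_integral_cos_power_trig(1)[OF P]
      unfolding T_def k_def by (cases "m = 0"; cases "m > 0") (simp_all add: mult_ac)
    then show ?thesis by (simp add: integral_unique)
  qed
  finally show ?thesis by simp
qed

subsection \<open>Differential operators in coordinates\<close>

abbreviation sph_series :: "real \<Rightarrow> (nat \<Rightarrow> nat \<Rightarrow> real) \<Rightarrow> real \<Rightarrow> real \<Rightarrow> real" where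
  "sph_series e c \<theta> \<phi> \<equiv> series2 c (e * (sin \<theta> * cos \<phi>)) (cos \<theta>)"

lemma abs_sin_cos_le: "\<bar>e\<bar> \<le> 1 \<Longrightarrow> \<bar>e * (sin \<theta> * cos \<phi>)\<bar> \<le> (1 :: real)"
  using mult_mono[of "\<bar>e\<bar>" 1 "\<bar>sin \<theta>\<bar> * \<bar>cos \<phi>\<bar>" "1 * 1"] mult_mono[of "\<bar>sin \<theta>\<bar>" 1 "\<bar>cos \<phi>\<bar>" 1]
  by (simp add: abs_mult)

lemma sph_series_derivatives:
  assumes c: "geo_bounded r c" and "r \<ge> 4" "\<bar>e\<bar> \<le> 1"
  shows "((\<lambda>t. sph_series e c t \<phi>) has_real_derivative
      (sph_series e (dX c) \<theta> \<phi> * (e * (cos \<theta> * cos \<phi>)) - sph_series e (dZ c) \<theta> \<phi> * sin \<theta>)) (at \<theta>)"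
    and "((\<lambda>p. sph_series e c \<theta> p) has_real_derivative
      (- sph_series e (dX c) \<theta> \<phi> * (e * (sin \<theta> * sin \<phi>)))) (at \<phi>)"
proof -
  have b: "\<bar>e * (sin \<theta> * cos \<phi>)\<bar> < r / 2" "\<bar>cos \<theta>\<bar> < r / 2"
    using abs_sin_cos_le[OF assms(3), of \<theta> \<phi>] abs_cos_le_one[of \<theta>] assms(2) by linarith+
  have "((\<lambda>t. sph_series e c t \<phi>) has_real_derivative
      (sph_series e (dX c) \<theta> \<phi> * (e * (cos \<theta> * cos \<phi>)) + sph_series e (dZ c) \<theta> \<phi> * (- sin \<theta>))) (at \<theta>)"
    by (rule series2_chain[OF c, where f = "\<lambda>t. e * (sin t * cos \<phi>)" and g = cos, OF b])
       (auto intro!: derivative_eq_intros)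
  then show "((\<lambda>t. sph_series e c t \<phi>) has_real_derivative
      (sph_series e (dX c) \<theta> \<phi> * (e * (cos \<theta> * cos \<phi>)) - sph_series e (dZ c) \<theta> \<phi> * sin \<theta>)) (at \<theta>)"
    by simp
  have "((\<lambda>p. sph_series e c \<theta> p) has_real_derivative
      (sph_series e (dX c) \<theta> \<phi> * (- (e * (sin \<theta> * sin \<phi>))) + sph_series e (dZ c) \<theta> \<phi> * 0)) (at \<phi>)"
    by (rule series2_chain[OF c, where f = "\<lambda>p. e * (sin \<theta> * cos p)" and g = "\<lambda>p. cos \<theta>", OF b])
       (auto intro!: derivative_eq_intros)
  then show "((\<lambda>p. sph_series e c \<theta> p) has_real_derivative
      (- sph_series e (dX c) \<theta> \<phi> * (e * (sin \<theta> * sin \<phi>)))) (at \<phi>)"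
    by simp
qed

text \<open>The right-hand side is the Euclidean Laplacian of the extension independent of the
  second coordinate, minus its radial part at radius 1: the second radial derivative plus twice the
  first. As \<open>x\<close> includes the scaling, only the pure second derivative keeps a factor
  \<open>e^2\<close>.\<close>

lemma laplace_beltrami_sph_series:
  fixes c :: "nat \<Rightarrow> nat \<Rightarrow> real"
  assumes c: "geo_bounded r c" and r: "r \<ge> 8" and e: "\<bar>e\<bar> \<le> 1" and s: "sin \<theta> \<noteq> 0"
    and x_def: "x = e * (sin \<theta> * cos \<phi>)" and z_def: "z = cos \<theta>"
  shows "laplace_beltrami (sph_series e c) \<theta> \<phi> =
    e\<^sup>2 * series2 (dX (dX c)) x z + series2 (dZ (dZ c)) x z
     - (x\<^sup>2 * series2 (dX (dX c)) x z + 2 * x * z * series2 (dZ (dX c)) x z + z\<^sup>2 * series2 (dZ (dZ c)) x z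
        + 2 * x * series2 (dX c) x z + 2 * z * series2 (dZ c) x z)"
proof -
  have r4: "r / 2 \<ge> 4" "r \<ge> 4" using r by auto
  have dt: "d_theta (sph_series e c) = (\<lambda>t p. sph_series e (dX c) t p * (e * (cos t * cos p)) - sph_series e (dZ c) t p * sin t)"
    unfolding d_theta_def by (intro ext DERIV_imp_deriv sph_series_derivatives(1)[OF c r4(2) e])
  have dp: "d_phi (sph_series e c) = (\<lambda>t p. - sph_series e (dX c) t p * (e * (sin t * sin p)))"
    unfolding d_phi_def by (intro ext DERIV_imp_deriv sph_series_derivatives(2)[OF c r4(2) e])
  define ux uz uxx uxz uzz where "ux = series2 (dX c) x z" and "uz = series2 (dZ c) x z"
    and "uxx = series2 (dX (dX c)) x z" and "uxz = series2 (dZ (dX c)) x z" and "uzz = series2 (dZ (dZ c)) x z"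
  note defs = ux_def uz_def uxx_def uxz_def uzz_def x_def z_def
  let ?C = "cos \<theta>" and ?S = "sin \<theta>" and ?c = "cos \<phi>" and ?s = "sin \<phi>"
  have 1: "d_theta (\<lambda>t p. sin t * d_theta (sph_series e c) t p) \<theta> \<phi> =
     ?C * (ux * (e * (?C * ?c)) - uz * ?S) + ?S *
     ((uxx * (e * (?C * ?c)) - uxz * ?S) * (e * (?C * ?c)) - ux * (e * (?S * ?c))
      - ((uxz * (e * (?C * ?c)) - uzz * ?S) * ?S + uz * ?C))"
    unfolding dt unfolding d_theta_def
    by (rule DERIV_imp_deriv,
        (rule sph_series_derivatives(1)[OF geo_bounded_dX[OF c] r4(1) e]
          sph_series_derivatives(1)[OF geo_bounded_dZ[OF c] r4(1) e] derivative_eq_intros refl)+)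
       (simp add: defs dX_dZ_commute algebra_simps)
  have 2: "d_phi (d_phi (sph_series e c)) \<theta> \<phi> =
     (uxx * (e * (?S * ?s))) * (e * (?S * ?s)) - ux * (e * (?S * ?c))"
    unfolding dp unfolding d_phi_def
    by (rule DERIV_imp_deriv,
        (rule sph_series_derivatives(2)[OF geo_bounded_dX[OF c] r4(1) e] derivative_eq_intros refl)+)
       (simp add: defs algebra_simps)
  have CS: "?C\<^sup>2 = 1 - ?S\<^sup>2" "?s\<^sup>2 = 1 - ?c\<^sup>2" by (rule cos_squared_eq sin_squared_eq)+
  have "laplace_beltrami (sph_series e c) \<theta> \<phi> =
     e * ?c * ux * (?C\<^sup>2 / ?S - ?S - 1 / ?S) - 2 * ?C * uz - 2 * e * ?S * ?c * ?C * uxz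
     + uxx * e\<^sup>2 * (?C\<^sup>2 * ?c\<^sup>2 + ?s\<^sup>2) + uzz * ?S\<^sup>2"
    unfolding laplace_beltrami_def 1 2 using s by (simp add: field_simps power2_eq_square)
  \<comment> \<open>The singular terms of the colatitude and longitude parts cancel here.\<close>
  also have "?C\<^sup>2 / ?S - ?S - 1 / ?S = - 2 * ?S"
    unfolding CS using s by (simp add: field_simps power2_eq_square)
  also have "?C\<^sup>2 * ?c\<^sup>2 + ?s\<^sup>2 = 1 - ?S\<^sup>2 * ?c\<^sup>2"
    unfolding CS by (simp add: algebra_simps)
  also have "?S\<^sup>2 = 1 - ?C\<^sup>2" by (rule sin_squared_eq)
  also have "e * ?c * ux * (- 2 * ?S) - 2 * ?C * uz - 2 * e * ?S * ?c * ?C * uxz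
     + uxx * e\<^sup>2 * (1 - (1 - ?C\<^sup>2) * ?c\<^sup>2) + uzz * (1 - ?C\<^sup>2) =
     e\<^sup>2 * uxx + uzz - (x\<^sup>2 * uxx + 2 * x * z * uxz + z\<^sup>2 * uzz + 2 * x * ux + 2 * z * uz)"
    unfolding x_def z_def CS(1) by (simp add: algebra_simps power_mult_distrib)
  finally show ?thesis by (simp only: ux_def uz_def uxx_def uxz_def uzz_def)
qed

lemma rotJ_inner_self: "rotJ \<theta> \<phi> v \<bullet> v = 0"
  by (simp add: rotJ_def inner_diff_left inner_diff_right inner_commute)

text \<open>A functional relation between stream function and absolute vorticity makes their gradients parallel.\<close>

lemma steady_eulerI:
  assumes dt: "\<And>\<theta> \<phi>. 0 < \<theta> \<Longrightarrow> \<theta> < pi \<Longrightarrow> (\<lambda>t. in_coords \<Psi> t \<phi>) differentiable (at \<theta>)"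
    and dp: "\<And>\<theta> \<phi>. 0 < \<theta> \<Longrightarrow> \<theta> < pi \<Longrightarrow> (\<lambda>p. in_coords \<Psi> \<theta> p) differentiable (at \<phi>)"
    and g: "\<And>y. (g has_real_derivative g' y) (at y)"
    and eq: "\<And>\<theta> \<phi>. 0 < \<theta> \<Longrightarrow> \<theta> < pi \<Longrightarrow>
      laplace_beltrami (in_coords \<Psi>) \<theta> \<phi> - 4 * \<gamma> * in_coords (sph_harm 1 0) \<theta> \<phi> = g (in_coords \<Psi> \<theta> \<phi>)"
  shows "steady_euler \<gamma> \<Psi>"
  unfolding steady_euler_def
proof (intro allI impI)
  fix \<theta> \<phi> :: real assume t: "0 < \<theta> \<and> \<theta> < pi"
  let ?F = "in_coords \<Psi>"
  let ?W = "\<lambda>t p. laplace_beltrami ?F t p - 4 * \<gamma> * in_coords (sph_harm 1 0) t p"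
  have d: "((\<lambda>t. ?F t \<phi>) has_real_derivative d_theta ?F \<theta> \<phi>) (at \<theta>)"
    "((\<lambda>p. ?F \<theta> p) has_real_derivative d_phi ?F \<theta> \<phi>) (at \<phi>)"
    using dt[of \<theta> \<phi>] dp[of \<theta> \<phi>] t unfolding d_theta_def d_phi_def
    by (auto simp: DERIV_deriv_iff_real_differentiable)
  have "((\<lambda>t. g (?F t \<phi>)) has_real_derivative g' (?F \<theta> \<phi>) * d_theta ?F \<theta> \<phi>) (at \<theta>)"
    by (rule DERIV_chain2[OF g d(1)])
  then have "((\<lambda>t. ?W t \<phi>) has_real_derivative g' (?F \<theta> \<phi>) * d_theta ?F \<theta> \<phi>) (at \<theta>)"
    by (rule has_field_derivative_transform_within_open[of _ _ _ "{0<..<pi}"]) (use t eq in auto)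
  then have 1: "d_theta ?W \<theta> \<phi> = g' (?F \<theta> \<phi>) * d_theta ?F \<theta> \<phi>"
    unfolding d_theta_def by (rule DERIV_imp_deriv)
  have "(\<lambda>p. ?W \<theta> p) = (\<lambda>p. g (?F \<theta> p))" using eq t by auto
  then have 2: "d_phi ?W \<theta> \<phi> = g' (?F \<theta> \<phi>) * d_phi ?F \<theta> \<phi>"
    unfolding d_phi_def using DERIV_imp_deriv[OF DERIV_chain2[OF g d(2)]] by (simp add: d_phi_def)
  have "sgrad ?W \<theta> \<phi> = g' (?F \<theta> \<phi>) *\<^sub>R sgrad ?F \<theta> \<phi>"
    unfolding sgrad_def 1 2 by (simp add: scaleR_add_right mult_ac)
  then show "sgrad_perp ?F \<theta> \<phi> \<bullet> sgrad ?W \<theta> \<phi> = 0"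
    by (simp add: sgrad_perp_def rotJ_inner_self)
qed

section \<open>Excluding zonal functions plus elements of \<open>Y_2\<close>\<close>

lemma sph_pt_in_sphere: "sph_pt \<theta> \<phi> \<in> sphere 0 1"
proof -
  have "(sin \<theta> * cos \<phi>)\<^sup>2 + (sin \<theta> * sin \<phi>)\<^sup>2 + (cos \<theta>)\<^sup>2 = (sin \<theta>)\<^sup>2 * ((cos \<phi>)\<^sup>2 + (sin \<phi>)\<^sup>2) + (cos \<theta>)\<^sup>2"
    by (simp only: power_mult_distrib distrib_left)
  then show ?thesis
    by (simp add: sph_pt_def norm_eq_sqrt_inner inner_vec_def sum_3 flip: power2_eq_square)
qed

lemma nontrivial_imp_not_zonal: "nontrivial f \<Longrightarrow> \<not> zonal f"
proof
  assume "nontrivial f" "zonal f"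
  moreover have "in_Y2 (\<lambda>x. 0)"
    unfolding in_Y2_def by (rule exI[of _ "\<lambda>m. 0"]) simp
  ultimately show False
    unfolding nontrivial_def by force
qed

text \<open>At longitude \<open>pi / 2\<close> the derivatives of \<open>sin p\<close> and
  \<open>cos (2 p)\<close> vanish, so only the orders -2 and 1 contribute, that is, the multiples of
  \<open>xy\<close> and \<open>xz\<close>.\<close>

lemma in_Y2_dphi:
  assumes "in_Y2 h"
  obtains a b where "\<And>\<theta>. 0 < \<theta> \<Longrightarrow> \<theta> < pi \<Longrightarrow>
     ((\<lambda>p. h (sph_pt \<theta> p)) has_real_derivative sin \<theta> * (a * sin \<theta> + b * cos \<theta>)) (at (pi / 2))"
proof -
  obtain c where c: "\<And>x. x \<in> sphere 0 1 \<Longrightarrow> h x = (\<Sum>m=-2..2. c m * sph_harm 2 m x)"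
    using assms unfolding in_Y2_def by blast
  have I: "{-2..2::int} = {-2, -1, 0, 1, 2}" by auto
  define K where "K = sph_harm_const 2"
  have P: "poly (pderiv (legendre_poly 2)) t = 3 * t" "poly (pderiv (pderiv (legendre_poly 2))) t = 3" for t
    by (simp_all add: legendre_poly_def numeral_2_eq_2 pderiv_pCons pderiv_smult algebra_simps)
  have h: "h (sph_pt \<theta> p) = c 0 * sph_harm 2 0 (sph_pt \<theta> 0)
     + c (-2) * (K 2 * ((sin \<theta>)\<^sup>2 * 3) * (sqrt 2 * sin (2 * p)))
     + c (-1) * (K 1 * (sin \<theta> * (3 * cos \<theta>)) * (sqrt 2 * sin p))
     + c 1 * (K 1 * (sin \<theta> * (3 * cos \<theta>)) * (sqrt 2 * cos p))
     + c 2 * (K 2 * ((sin \<theta>)\<^sup>2 * 3) * (sqrt 2 * cos (2 * p)))" if t: "0 < \<theta>" "\<theta> < pi" for \<theta> p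
  proof -
    have "sqrt (1 - (cos \<theta>)\<^sup>2) = sin \<theta>"
      using sin_ge_zero[of \<theta>] t by (simp add: sin_squared_eq[symmetric])
    then have A: "assoc_legendre 2 1 (cos \<theta>) = sin \<theta> * (3 * cos \<theta>)" "assoc_legendre 2 2 (cos \<theta>) = (sin \<theta>)\<^sup>2 * 3"
      using P unfolding assoc_legendre_def by (simp_all add: numeral_2_eq_2)
    show ?thesis
      using t unfolding c[OF sph_pt_in_sphere] I
      by (simp add: sph_harm_sph_pt A[simplified] K_def)
  qed
  have "((\<lambda>p. h (sph_pt \<theta> p)) has_real_derivative
      sin \<theta> * (- 6 * sqrt 2 * c (-2) * K 2 * sin \<theta> + (- 3 * sqrt 2 * c 1 * K 1) * cos \<theta>)) (at (pi / 2))"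
    if t: "0 < \<theta>" "\<theta> < pi" for \<theta>
    unfolding h[OF t]
    by (auto intro!: derivative_eq_intros simp: power2_eq_square algebra_simps)
  then show ?thesis by (rule that)
qed

lemma series2_0_0: "series2 c 0 0 = c 0 0"
  by (rule series2_eqI, rule has_sum_finite_neutralI[of "{(0, 0)}"]) (auto simp: power_0_left split: if_splits)

lemma series2_dZ_unique:
  assumes "geo_bounded r c" "r \<ge> 2" "\<And>z. \<bar>z\<bar> < s \<Longrightarrow> series2 c 0 z = f z" "s \<le> 1"
    and "\<And>z. \<bar>z\<bar> < s \<Longrightarrow> (f has_real_derivative f' z) (at z)" "\<bar>z\<bar> < s"
  shows "series2 (dZ c) 0 z = f' z"
proof -
  have "((\<lambda>t. series2 c ((\<lambda>t. 0) t) ((\<lambda>t. t) t)) has_real_derivative (series2 (dX c) 0 z * 0 + series2 (dZ c) 0 z * 1)) (at z)"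
    by (rule series2_chain[OF assms(1)]) (use assms in \<open>auto intro!: derivative_eq_intros\<close>)
  then have 1: "(series2 c 0 has_real_derivative series2 (dZ c) 0 z) (at z)" by simp
  have "(series2 c 0 has_real_derivative f' z) (at z)"
    by (rule has_field_derivative_transform_within_open[OF assms(5)[OF assms(6)], of "{-s<..<s}"])
       (use assms in auto)
  with 1 show ?thesis by (rule DERIV_unique)
qed

text \<open>The longitude derivative removes the zonal part, and on the meridian
  \<open>x = 0\<close> it isolates the part of the series linear in \<open>x\<close>, which must
  match \<open>in_Y2_dphi\<close>. The equator gives \<open>a = 0\<close>, so this part is linear in
  \<open>z\<close> as well, and its third and fifth derivatives at 0 are multiples of
  \<open>c 1 3\<close> and \<open>c 1 5\<close>.\<close>

lemma nontrivial_series2: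
  assumes c: "geo_bounded 64 c" and e: "0 < e" "e \<le> 1"
    and c1: "c 1 0 = 0" "\<not> (c 1 3 = 0 \<and> c 1 5 = 0)"
    and F: "\<And>\<theta> \<phi>. F (sph_pt \<theta> \<phi>) = sph_series e c \<theta> \<phi>"
  shows "nontrivial F"
proof (rule ccontr)
  assume "\<not> nontrivial F"
  then obtain g h where gh: "zonal g" "in_Y2 h" "\<And>x. x \<in> sphere 0 1 \<Longrightarrow> F x = g x + h x"
    unfolding nontrivial_def by blast
  obtain G where G: "\<And>\<theta> \<phi>. 0 \<le> \<theta> \<Longrightarrow> \<theta> \<le> pi \<Longrightarrow> g (sph_pt \<theta> \<phi>) = G \<theta>"
    using gh(1) unfolding zonal_def by blast
  obtain a b where ab: "\<And>\<theta>. 0 < \<theta> \<Longrightarrow> \<theta> < pi \<Longrightarrow>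
     ((\<lambda>p. h (sph_pt \<theta> p)) has_real_derivative sin \<theta> * (a * sin \<theta> + b * cos \<theta>)) (at (pi / 2))"
    using in_Y2_dphi[OF gh(2)] by blast
  have ux: "- e * series2 (dX c) 0 (cos \<theta>) = a * sin \<theta> + b * cos \<theta>" if t: "0 < \<theta>" "\<theta> < pi" for \<theta>
  proof -
    have "h (sph_pt \<theta> p) = sph_series e c \<theta> p - G \<theta>" for p
      using gh(3)[OF sph_pt_in_sphere[of \<theta> p]] F[of \<theta> p] G[of \<theta> p] t by simp
    then have "((\<lambda>p. h (sph_pt \<theta> p)) has_real_derivative (- sph_series e (dX c) \<theta> (pi / 2) * (e * (sin \<theta> * sin (pi / 2))))) (at (pi / 2))"
      using sph_series_derivatives(2)[OF c _ , of e \<theta> "pi / 2"] e by (auto intro!: derivative_eq_intros)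
    from DERIV_unique[OF this ab[OF t]]
    have "sin \<theta> * (- e * series2 (dX c) 0 (cos \<theta>)) = sin \<theta> * (a * sin \<theta> + b * cos \<theta>)"
      by (simp add: mult_ac)
    then show ?thesis using sin_gt_zero[OF t] by (simp only: mult_left_cancel)
  qed
  have 0: "dX c 0 0 = 0" using c1 by (simp add: dX_def)
  then have a: "a = 0" using ux[of "pi / 2"] by (simp add: series2_0_0)
  define B where "B = - b / e"
  have s0: "series2 (dX c) 0 z = B * z" if "\<bar>z\<bar> < 1" for z
    using ux[of "arccos z"] that a arccos_lt_bounded[of z] e by (simp add: B_def field_simps cos_arccos_abs)
  \<comment> \<open>The radii are 32, 16, 8, 4, 2, 1; the fifth derivative in \<open>z\<close>
    starts from radius 2, just what \<open>series2_dZ_unique\<close> asks for.\<close>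
  note gX = geo_bounded_dX[OF c]
  note g1 = geo_bounded_dZ[OF gX] note g2 = geo_bounded_dZ[OF g1] note g3 = geo_bounded_dZ[OF g2]
  note g4 = geo_bounded_dZ[OF g3] note g5 = geo_bounded_dZ[OF g4]
  have s1: "series2 (dZ (dX c)) 0 z = B" if "\<bar>z\<bar> < 1" for z
    by (rule series2_dZ_unique[OF gX _ s0 _ _ that]) (auto intro!: derivative_eq_intros)
  have s2: "series2 (dZ (dZ (dX c))) 0 z = 0" if "\<bar>z\<bar> < 1" for z
    by (rule series2_dZ_unique[OF g1 _ s1 _ _ that]) (auto intro!: derivative_eq_intros)
  have s3: "series2 (dZ (dZ (dZ (dX c)))) 0 z = 0" if "\<bar>z\<bar> < 1" for z
    by (rule series2_dZ_unique[OF g2 _ s2 _ _ that]) (auto intro!: derivative_eq_intros)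
  have s4: "series2 (dZ (dZ (dZ (dZ (dX c))))) 0 z = 0" if "\<bar>z\<bar> < 1" for z
    by (rule series2_dZ_unique[OF g3 _ s3 _ _ that]) (auto intro!: derivative_eq_intros)
  have s5: "series2 (dZ (dZ (dZ (dZ (dZ (dX c)))))) 0 z = 0" if "\<bar>z\<bar> < 1" for z
    by (rule series2_dZ_unique[OF g4 _ s4 _ _ that]) (auto intro!: derivative_eq_intros)
  have "c 1 3 = 0" "c 1 5 = 0"
    using s3[of 0] s5[of 0] by (simp_all add: series2_0_0 dZ_def dX_def numeral_eq_Suc)
  with c1 show False by blast
qed

subsection \<open>Gevrey bounds\<close>

lemma continuous_on_sph_series:
  assumes c: "geo_bounded r c" and "r \<ge> 4"
  shows "continuous_on A (\<lambda>(\<theta>, \<phi>). sph_series 1 c \<theta> \<phi>)"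
proof -
  let ?S = "{-2<..<2} \<times> {-2<..<2} :: (real \<times> real) set"
  have "continuous_on ?S (\<lambda>(x, z). series2 c x z)"
  proof (rule continuous_at_imp_continuous_on, safe)
    fix x z :: real assume "x \<in> {-2<..<2}" "z \<in> {-2<..<2}"
    then have "((\<lambda>(x, z). series2 c x z) has_derivative
       (\<lambda>(h, k). series2 (dX c) x z * h + series2 (dZ c) x z * k)) (at (x, z))"
      using assms by (intro series2_has_derivative[OF c]) auto
    then show "isCont (\<lambda>(x, z). series2 c x z) (x, z)" by (rule has_derivative_continuous)
  qed
  moreover have "continuous_on A (\<lambda>(\<theta>, \<phi>). (1 * (sin \<theta> * cos \<phi>), cos \<theta>))"
    unfolding case_prod_unfold by (intro continuous_intros)
  moreover have "(\<lambda>(\<theta>, \<phi>). (1 * (sin \<theta> * cos \<phi>), cos \<theta>)) ` A \<subseteq> ?S"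
  proof safe
    fix \<theta> \<phi> :: real
    have "\<bar>1 * (sin \<theta> * cos \<phi>)\<bar> \<le> 1" by (rule abs_sin_cos_le) simp
    then show "1 * (sin \<theta> * cos \<phi>) \<in> {-2<..<2}" by auto
    have "\<bar>cos \<theta>\<bar> < 2" using abs_cos_le_one[of \<theta>] by linarith
    then show "cos \<theta> \<in> {-2<..<2}" by auto
  qed
  ultimately have "continuous_on A (\<lambda>x. (\<lambda>(x, z). series2 c x z) ((\<lambda>(\<theta>, \<phi>). (1 * (sin \<theta> * cos \<phi>), cos \<theta>)) x))"
    by (rule continuous_on_compose2)
  then show ?thesis by (simp add: case_prod_unfold)
qed

text \<open>The coefficient of degree \<open>n\<close> only sees the part of the series of degree at least \<open>n\<close>.\<close>

lemma sph_coeff_bound: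
  assumes d: "\<And>i j. \<bar>d i j\<bar> \<le> K / 64 ^ (i + j)" and m: "\<bar>m\<bar> \<le> int n"
    and u: "\<And>\<theta> \<phi>. u (sph_pt \<theta> \<phi>) = sph_series 1 d \<theta> \<phi>"
  shows "\<bar>sph_coeff u n m\<bar> \<le> 128 * K / 4 ^ n"
proof -
  have K: "0 \<le> K" using d[of 0 0] by simp
  define t where "t = (\<lambda>i j. if i + j < n then 0 else d i j)"
  have gd: "geo_bounded 64 d" using d unfolding geo_bounded_def by auto
  have gt: "geo_bounded 64 t" unfolding geo_bounded_def t_def
    by (rule conjI[OF _ exI[of _ K]]) (use d K in auto)
  define I where "I = {(i, j). i + j < n}"
  have I: "finite I"
    by (rule finite_subset[of _ "{..<n} \<times> {..<n}"]) (auto simp: I_def)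
  have split: "series2 d x z = series2 t x z + (\<Sum>(i, j)\<in>I. d i j * (x ^ i * z ^ j))"
    if "\<bar>x\<bar> \<le> 1" "\<bar>z\<bar> \<le> 1" for x z
  proof (rule series2_eqI)
    have "((\<lambda>(i, j). (if (i, j) \<in> I then d i j else 0) * (x ^ i * z ^ j)) has_sum (\<Sum>(i, j)\<in>I. d i j * (x ^ i * z ^ j))) UNIV"
      by (rule has_sum_finite_neutralI[OF I]) (auto intro!: sum.cong split: if_splits)
    moreover have "((\<lambda>(i, j). t i j * x ^ i * z ^ j) has_sum series2 t x z) UNIV"
      by (rule series2_has_sum[OF gt]) (use that in auto)
    ultimately have "((\<lambda>p. (case p of (i, j) \<Rightarrow> t i j * x ^ i * z ^ j) + (case p of (i, j) \<Rightarrow> (if (i, j) \<in> I then d i j else 0) * (x ^ i * z ^ j)))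
       has_sum (series2 t x z + (\<Sum>(i, j)\<in>I. d i j * (x ^ i * z ^ j)))) UNIV"
      by (intro has_sum_add)
    then show "((\<lambda>(i, j). d i j * x ^ i * z ^ j) has_sum (series2 t x z + (\<Sum>(i, j)\<in>I. d i j * (x ^ i * z ^ j)))) UNIV"
      by (rule iffD1[OF has_sum_cong, rotated]) (auto simp: t_def I_def)
  qed
  \<comment> \<open>In degrees at least \<open>n\<close>, \<open>64^(i + j)\<close> dominates
    \<open>32^n * 2^(i + j)\<close>. The factor \<open>32^-n\<close> later beats the growth
    \<open>8^n\<close> of the harmonics, and the powers of \<open>1 / 2\<close> sum to 4.\<close>
  have tail: "\<bar>series2 t x z\<bar> \<le> 4 * K / 32 ^ n" if "\<bar>x\<bar> \<le> 1" "\<bar>z\<bar> \<le> 1" for x z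
  proof -
    have 1: "((\<lambda>p. K / 32 ^ n * (case p of (i, j) \<Rightarrow> (1 / 2) ^ i * (1 / 2) ^ j)) has_sum
        (K / 32 ^ n * (1 / (1 - 1 / 2) * (1 / (1 - 1 / 2))))) UNIV"
      by (intro has_sum_cmult_right geometric2_has_sum) auto
    have 2: "((\<lambda>(i, j). t i j * x ^ i * z ^ j) has_sum series2 t x z) UNIV"
      by (rule series2_has_sum[OF gt]) (use that in auto)
    have 3: "norm (case p of (i, j) \<Rightarrow> t i j * x ^ i * z ^ j) \<le>
        K / 32 ^ n * (case p of (i, j) \<Rightarrow> (1 / 2) ^ i * (1 / 2) ^ j)" for p :: "nat \<times> nat"
    proof -
      obtain i j where p: "p = (i, j)" by (cases p)
      have "\<bar>t i j * x ^ i * z ^ j\<bar> \<le> \<bar>t i j\<bar> * 1 * 1"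
        unfolding abs_mult power_abs by (intro mult_mono power_le_one) (use that in auto)
      also have "\<bar>t i j\<bar> * 1 * 1 \<le> K / 32 ^ n * ((1 / 2) ^ i * (1 / 2) ^ j)"
      proof (cases "i + j < n")
        case False
        then have "(32 :: real) ^ n \<le> 32 ^ (i + j)" by (intro power_increasing) auto
        then have "32 ^ n * 2 ^ (i + j) \<le> (32 :: real) ^ (i + j) * 2 ^ (i + j)"
          by (intro mult_right_mono) auto
        then have "32 ^ n * 2 ^ (i + j) \<le> (64 :: real) ^ (i + j)"
          by (simp flip: power_mult_distrib)
        then have "K / 64 ^ (i + j) \<le> K / (32 ^ n * 2 ^ (i + j))"
          using K by (intro divide_left_mono) auto
        then show ?thesis using False d[of i j] by (simp add: t_def power_one_over power_add)
      qed (use K in \<open>simp add: t_def\<close>)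
      finally show ?thesis by (simp add: p)
    qed
    from norm_infsum_le[OF 2 1 3] show ?thesis by (simp add: mult.commute)
  qed
  let ?B = "{0..pi} \<times> {0..2 * pi}"
  have B: "?B = cbox (0, 0) (pi, 2 * pi)" by (simp add: cbox_Pair_eq)
  let ?Y = "\<lambda>\<theta> \<phi>. sph_harm n m (sph_pt \<theta> \<phi>) * sin \<theta>"
  have cY: "continuous_on ?B (\<lambda>(\<theta>, \<phi>). ?Y \<theta> \<phi>)"
    using continuous_on_mult[OF continuous_sph_harm[of n m], of "\<lambda>x. sin (fst x)"]
    by (simp add: case_prod_unfold continuous_intros)
  have ct: "continuous_on ?B (\<lambda>(\<theta>, \<phi>). sph_series 1 t \<theta> \<phi> * ?Y \<theta> \<phi>)"
    using continuous_on_mult[OF continuous_on_sph_series[OF gt] cY] by (simp add: case_prod_unfold)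
  have cm: "continuous_on ?B (\<lambda>(\<theta>, \<phi>). (sin \<theta> * cos \<phi>) ^ i * cos \<theta> ^ j * ?Y \<theta> \<phi>)" for i j
    using continuous_on_mult[OF _ cY, of "\<lambda>(\<theta>, \<phi>). (sin \<theta> * cos \<phi>) ^ i * cos \<theta> ^ j"]
    by (simp add: case_prod_unfold continuous_intros)
  have int: "f integrable_on ?B" if "continuous_on ?B f" for f :: "real \<times> real \<Rightarrow> real"
    using that unfolding B by (rule integrable_continuous)
  have ab: "\<bar>sin \<theta> * cos \<phi>\<bar> \<le> 1" for \<theta> \<phi> :: real
    using abs_sin_cos_le[of 1 \<theta> \<phi>] by simp
  have "sph_coeff u n m = integral ?B (\<lambda>x. (case x of (\<theta>, \<phi>) \<Rightarrow> sph_series 1 t \<theta> \<phi> * ?Y \<theta> \<phi>) +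
      (\<Sum>q\<in>I. d (fst q) (snd q) * (case x of (\<theta>, \<phi>) \<Rightarrow> (sin \<theta> * cos \<phi>) ^ fst q * cos \<theta> ^ snd q * ?Y \<theta> \<phi>)))"
    unfolding sph_coeff_def
  proof (intro integral_cong)
    fix x assume "x \<in> ?B"
    obtain \<theta> \<phi> where x: "x = (\<theta>, \<phi>)" by (cases x)
    have sp: "sph_series 1 d \<theta> \<phi> = sph_series 1 t \<theta> \<phi> +
        (\<Sum>q\<in>I. d (fst q) (snd q) * ((sin \<theta> * cos \<phi>) ^ fst q * cos \<theta> ^ snd q))"
      using split[of "sin \<theta> * cos \<phi>" "cos \<theta>"] ab[of \<theta> \<phi>] by (simp add: case_prod_unfold)
    show "(case x of (\<theta>, \<phi>) \<Rightarrow> u (sph_pt \<theta> \<phi>) * sph_harm n m (sph_pt \<theta> \<phi>) * sin \<theta>) =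
      (case x of (\<theta>, \<phi>) \<Rightarrow> sph_series 1 t \<theta> \<phi> * ?Y \<theta> \<phi>) +
      (\<Sum>q\<in>I. d (fst q) (snd q) * (case x of (\<theta>, \<phi>) \<Rightarrow> (sin \<theta> * cos \<phi>) ^ fst q * cos \<theta> ^ snd q * ?Y \<theta> \<phi>))"
      unfolding x prod.case u sp distrib_right sum_distrib_right by (simp only: mult.assoc)
  qed
  also have "\<dots> = integral ?B (\<lambda>(\<theta>, \<phi>). sph_series 1 t \<theta> \<phi> * ?Y \<theta> \<phi>) +
      (\<Sum>q\<in>I. d (fst q) (snd q) * integral ?B (\<lambda>(\<theta>, \<phi>). (sin \<theta> * cos \<phi>) ^ fst q * cos \<theta> ^ snd q * ?Y \<theta> \<phi>))"
    by (subst integral_add, rule int[OF ct], rule integrable_sum[OF I], rule integrable_on_mult_right, rule int[OF cm])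
       (subst integral_sum[OF I], rule integrable_on_mult_right, rule int[OF cm], simp)
  also have "(\<Sum>q\<in>I. d (fst q) (snd q) * integral ?B (\<lambda>(\<theta>, \<phi>). (sin \<theta> * cos \<phi>) ^ fst q * cos \<theta> ^ snd q * ?Y \<theta> \<phi>)) = 0"
  proof (intro sum.neutral ballI)
    fix q assume "q \<in> I"
    then have "integral ?B (\<lambda>(\<theta>, \<phi>). (sin \<theta> * cos \<phi>) ^ fst q * cos \<theta> ^ snd q * ?Y \<theta> \<phi>) = 0"
      using sph_harm_monomial_orthogonal[of "fst q" "snd q" n m] by (simp add: I_def case_prod_unfold mult.assoc)
    then show "d (fst q) (snd q) * integral ?B (\<lambda>(\<theta>, \<phi>). (sin \<theta> * cos \<phi>) ^ fst q * cos \<theta> ^ snd q * ?Y \<theta> \<phi>) = 0"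
      by simp
  qed
  finally have eq: "sph_coeff u n m = integral ?B (\<lambda>(\<theta>, \<phi>). sph_series 1 t \<theta> \<phi> * ?Y \<theta> \<phi>)" by simp
  have "norm (integral ?B (\<lambda>(\<theta>, \<phi>). sph_series 1 t \<theta> \<phi> * ?Y \<theta> \<phi>)) \<le> (4 * K / 32 ^ n * 8 ^ n) * measure lborel (cbox (0, 0) (pi, 2 * pi))"
  proof (rule has_integral_bound)
    show "0 \<le> 4 * K / 32 ^ n * 8 ^ n" using K by simp
    show "((\<lambda>(\<theta>, \<phi>). sph_series 1 t \<theta> \<phi> * ?Y \<theta> \<phi>) has_integral integral ?B (\<lambda>(\<theta>, \<phi>). sph_series 1 t \<theta> \<phi> * ?Y \<theta> \<phi>)) (cbox (0, 0) (pi, 2 * pi))"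
      unfolding B[symmetric] by (rule integrable_integral[OF int[OF ct]])
    fix x assume x: "x \<in> cbox (0, 0) (pi, 2 * pi)"
    obtain \<theta> \<phi> where x': "x = (\<theta>, \<phi>)" "0 \<le> \<theta>" "\<theta> \<le> pi"
      using x unfolding B[symmetric] by auto
    have "\<bar>sph_series 1 t \<theta> \<phi>\<bar> * (\<bar>sph_harm n m (sph_pt \<theta> \<phi>)\<bar> * \<bar>sin \<theta>\<bar>) \<le> (4 * K / 32 ^ n) * (8 ^ n * 1)"
      by (intro mult_mono tail sph_harm_bound m x'(2,3)) (use K ab in auto)
    then show "norm (case x of (\<theta>, \<phi>) \<Rightarrow> sph_series 1 t \<theta> \<phi> * ?Y \<theta> \<phi>) \<le> 4 * K / 32 ^ n * 8 ^ n"
      by (simp add: x' abs_mult)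
  qed
  also have "4 * K / 32 ^ n * 8 ^ n = 4 * K / 4 ^ n"
  proof -
    have "(32 :: real) ^ n = 4 ^ n * 8 ^ n" by (simp flip: power_mult_distrib)
    then show ?thesis by simp
  qed
  also have "measure lborel (cbox (0, 0) (pi, 2 * pi)) = 2 * (pi * pi)"
    by (simp add: content_Pair)
  \<comment> \<open>Bounding the area of the coordinate rectangle by 32 yields the constant
    \<open>4 * 32 = 128\<close>.\<close>
  also have "4 * K / 4 ^ n * (2 * (pi * pi)) \<le> 4 * K / 4 ^ n * (2 * (4 * 4))"
    by (intro mult_left_mono mult_mono) (use K pi_less_4 in auto)
  finally show ?thesis by (simp add: eq)
qed

text \<open>The exponential is at most \<open>2^(n + 1)\<close>, the number of orders and
  \<open>mu n\<close> squared give a polynomial of degree 5 absorbed by a multiple of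
  \<open>(3 / 2)^(5 n)\<close>, and the squared coefficients decay like \<open>16^-n\<close>. The
  ratio \<open>243 / 32 * 2 / 16 = 243 / 256\<close> is below 1, which is why the Gevrey index
  \<open>1 / 4\<close> works.\<close>

lemma gevrey_term_bound:
  assumes "\<And>m. \<bar>m\<bar> \<le> int n \<Longrightarrow> \<bar>sph_coeff u n m\<bar> \<le> C / 4 ^ n"
  shows "0 \<le> gevrey_term (1 / 4) u n" "gevrey_term (1 / 4) u n \<le> C\<^sup>2 * 128 * (243 / 256) ^ n"
proof -
  show "0 \<le> gevrey_term (1 / 4) u n" unfolding gevrey_term_def by (intro sum_nonneg) auto
  have mu: "0 \<le> mu n" "mu n \<le> (real n + 1)\<^sup>2"
    by (auto simp: mu_def eigval_def power2_eq_square algebra_simps)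
  then have s: "sqrt (mu n) \<le> real n + 1" by (intro real_le_lsqrt) auto
  have "gevrey_term (1 / 4) u n \<le> (\<Sum>m=-int n..int n. ((real n + 1)\<^sup>2)\<^sup>2 * exp (real n / 2 + 1 / 2) * (C / 4 ^ n)\<^sup>2)"
    unfolding gevrey_term_def
  proof (intro sum_mono mult_mono)
    fix m assume "m \<in> {-int n..int n}"
    then have "\<bar>sph_coeff u n m\<bar>\<^sup>2 \<le> (C / 4 ^ n)\<^sup>2" by (intro power_mono assms) auto
    then show "(sph_coeff u n m)\<^sup>2 \<le> (C / 4 ^ n)\<^sup>2" by simp
    show "(mu n)\<^sup>2 \<le> ((real n + 1)\<^sup>2)\<^sup>2" using mu by (intro power_mono)
  qed (use s in auto)
  also have "\<dots> = C\<^sup>2 * ((2 * real n + 1) * (real n + 1) ^ 4 * exp (real n / 2 + 1 / 2) / 16 ^ n)"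
  proof -
    have "((4 :: real) ^ n)\<^sup>2 = 16 ^ n" by (simp add: power2_eq_square flip: power_mult_distrib)
    then show ?thesis by (simp add: power_divide flip: power_mult)
  qed
  also have "(2 * real n + 1) * (real n + 1) ^ 4 * exp (real n / 2 + 1 / 2) / 16 ^ n
      \<le> 64 * (243 / 32) ^ n * 2 ^ (n + 1) / 16 ^ n"
  proof (rule divide_right_mono[OF mult_mono])
    have "real n + 1 \<le> 2 * (3 / 2) ^ n"
    proof (induction n)
      case (Suc n)
      then show ?case by (cases n) auto
    qed simp
    then have "(real n + 1) ^ 5 \<le> (2 * (3 / 2) ^ n) ^ 5" by (intro power_mono) auto
    also have "\<dots> = 32 * (243 / 32) ^ n"
      by (simp add: power_mult_distrib power_divide flip: power_mult) (simp add: mult.commute[of n] power_mult)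
    finally have "2 * (real n + 1) ^ 5 \<le> 64 * (243 / 32) ^ n" by simp
    moreover have "(2 * real n + 1) * (real n + 1) ^ 4 \<le> (2 * (real n + 1)) * (real n + 1) ^ 4"
      by (intro mult_right_mono) auto
    moreover have "(2 * (real n + 1)) * (real n + 1) ^ 4 = 2 * (real n + 1) ^ 5"
      by (simp add: numeral_eq_Suc)
    ultimately show "(2 * real n + 1) * (real n + 1) ^ 4 \<le> 64 * (243 / 32) ^ n" by linarith
    have "exp (1 / 2 :: real) ^ 2 \<le> 2 ^ 2"
      using exp_le by (simp flip: exp_of_nat_mult)
    then have "exp (1 / 2 :: real) \<le> 2" by (rule power2_le_imp_le) simp
    then have "exp (1 / 2 :: real) ^ (n + 1) \<le> 2 ^ (n + 1)" by (intro power_mono) auto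
    moreover have "exp (1 / 2 :: real) ^ (n + 1) = exp (real n / 2 + 1 / 2)"
      unfolding exp_of_nat_mult[symmetric] by (simp add: algebra_simps add_divide_distrib)
    ultimately show "exp (real n / 2 + 1 / 2) \<le> 2 ^ (n + 1)" by simp
  qed auto
  also have "64 * (243 / 32) ^ n * 2 ^ (n + 1) / 16 ^ n = 128 * (243 / 256 :: real) ^ n"
  proof -
    have "(256 :: real) ^ n = 32 ^ n * 8 ^ n" "(16 :: real) ^ n = 8 ^ n * 2 ^ n"
      by (simp_all flip: power_mult_distrib)
    then show ?thesis by (simp add: power_divide)
  qed
  finally show "gevrey_term (1 / 4) u n \<le> C\<^sup>2 * 128 * (243 / 256) ^ n"
    by (simp add: mult_left_mono mult.assoc)
qed

lemma gevrey_norm_bound: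
  assumes C: "0 \<le> C" and u: "\<And>n m. \<bar>m\<bar> \<le> int n \<Longrightarrow> \<bar>sph_coeff u n m\<bar> \<le> C / 4 ^ n"
  shows "gevrey_finite (1 / 4) u" "0 \<le> gevrey_norm (1 / 4) u" "gevrey_norm (1 / 4) u \<le> 51 * C"
proof -
  note b = gevrey_term_bound[OF u]
  have "(\<lambda>n. C\<^sup>2 * 128 * (243 / 256) ^ n) sums (C\<^sup>2 * 128 * (1 / (1 - 243 / 256)))"
    by (intro sums_mult geometric_sums) simp
  then have s: "summable (\<lambda>n. C\<^sup>2 * 128 * (243 / 256) ^ n)"
    and S: "(\<Sum>n. C\<^sup>2 * 128 * (243 / 256) ^ n) = C\<^sup>2 * (32768 / 13)"
    using sums_unique sums_summable by force+
  show f: "gevrey_finite (1 / 4) u"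
    unfolding gevrey_finite_def
    by (rule summable_comparison_test'[OF s, of 0]) (use b in auto)
  show "0 \<le> gevrey_norm (1 / 4) u"
    unfolding gevrey_norm_def using f b(1) by (auto simp: gevrey_finite_def intro!: suminf_nonneg)
  have "(\<Sum>n. gevrey_term (1 / 4) u n) \<le> (\<Sum>n. C\<^sup>2 * 128 * (243 / 256) ^ n)"
    by (rule suminf_le) (use b f s in \<open>auto simp: gevrey_finite_def\<close>)
  \<comment> \<open>The constant 51 is a rounding: \<open>32768 / 13 < 2601 = 51^2\<close>.\<close>
  also have "\<dots> \<le> (51 * C)\<^sup>2"
    unfolding S power_mult_distrib by simp
  finally show "gevrey_norm (1 / 4) u \<le> 51 * C"
    unfolding gevrey_norm_def using C by (intro real_le_lsqrt) auto
qed

section \<open>From coefficients to steady flows\<close>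

lemma steady_solution_exists:
  assumes \<kappa>: "\<kappa> = \<gamma> / 2 * sqrt (3 / pi)" "\<kappa> \<noteq> 0" and e: "0 < e" "e \<le> 1 / 2 ^ 60"
  shows "\<exists>\<Psi>. analytic_on_sphere \<Psi> \<and> nontrivial \<Psi> \<and> steady_euler \<gamma> \<Psi> \<and>
    (\<forall>n m. \<bar>m\<bar> \<le> int n \<longrightarrow>
       \<bar>sph_coeff (\<lambda>x. \<gamma> * sph_harm 1 0 x - \<Psi> x) n m\<bar> \<le> (128 * (\<bar>\<kappa>\<bar> * 2 ^ 60 * e)) / 4 ^ n)"
proof -
  obtain c where c: "majorized (e * 2 ^ 59) (\<lambda>i j. c i j - base i j)" "c 1 1 = 1"
    "\<And>i j. e\<^sup>2 * (real i + 2) * (real i + 1) * c (i + 2) j + (real j + 2) * (real j + 1) * c i (j + 2)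
       - eigdiff i j * c i j = dispersion e c * c i j + e * cube c i j + (if (i, j) = (0, 1) then 4 else 0)"
    "\<And>i j. even j \<Longrightarrow> c i j = 0" "\<not> (c 1 3 = 0 \<and> c 1 5 = 0)"
    using coefficients_exist[OF e] by blast
  have e1: "e \<le> 1" "\<bar>e\<bar> \<le> 1" using e by auto
  have cM: "majorized (e * 2 ^ 59 + 2 ^ 16) c"
    using majorized_add[OF c(1) majorized_base] by simp
  have gc: "geo_bounded 64 c" using cM by (rule geo_bounded_majorized)
  define k where "k = (\<lambda>i j. \<kappa> * c i j)"
  have gk: "geo_bounded 64 k" unfolding k_def by (rule geo_bounded_cmult[OF gc])
  define \<Psi> where "\<Psi> = (\<lambda>x :: real^3. series2 k (e * x $ 1) (x $ 3))"
  have \<Psi>: "\<Psi> (sph_pt \<theta> \<phi>) = sph_series e k \<theta> \<phi>" for \<theta> \<phi>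
    by (simp add: \<Psi>_def sph_pt_def)
  have in\<Psi>: "in_coords \<Psi> = sph_series e k" by (intro ext) (simp add: in_coords_def \<Psi>)
  have "analytic_on_sphere \<Psi>"
    unfolding \<Psi>_def series2_scale
    by (rule analytic_on_sphere_series2[OF geo_bounded_scale[OF gk e1(2)]]) simp
  moreover have "nontrivial \<Psi>"
    by (rule nontrivial_series2[OF gk e(1) e1(1) _ _ \<Psi>]) (use c(4)[of 0 1] c(5) \<kappa> in \<open>auto simp: k_def\<close>)
  moreover have "steady_euler \<gamma> \<Psi>"
  \<comment> \<open>In terms of \<open>\<Psi> = \<kappa> u\<close>, the term
    \<open>\<kappa> e u^3\<close> becomes \<open>e / \<kappa>^2\<close> times the cube of
    \<open>\<Psi>\<close>.\<close>
  proof (rule steady_eulerI[where g = "\<lambda>y. (dispersion e c - 6) * y + e / \<kappa>\<^sup>2 * y ^ 3"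
        and g' = "\<lambda>y. (dispersion e c - 6) + e / \<kappa>\<^sup>2 * (3 * y\<^sup>2)"])
    show "(\<lambda>t. in_coords \<Psi> t \<phi>) differentiable (at \<theta>)" "(\<lambda>p. in_coords \<Psi> \<theta> p) differentiable (at \<phi>)" for \<theta> \<phi>
      unfolding in\<Psi> real_differentiable_def
      by (rule exI, rule sph_series_derivatives[OF gk _ e1(2)], simp)+
    show "((\<lambda>y. (dispersion e c - 6) * y + e / \<kappa>\<^sup>2 * y ^ 3) has_real_derivative
        (dispersion e c - 6) + e / \<kappa>\<^sup>2 * (3 * y\<^sup>2)) (at y)" for y
    proof -
      have "((\<lambda>y. a * y + q * y ^ 3) has_real_derivative a + q * (3 * y\<^sup>2)) (at y)" for a q :: real
        by (auto intro!: derivative_eq_intros)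
      then show ?thesis .
    qed
    fix \<theta> \<phi> :: real assume t: "0 < \<theta>" "\<theta> < pi"
    define x z where "x = e * (sin \<theta> * cos \<phi>)" and "z = cos \<theta>"
    have b: "\<bar>x\<bar> < 16" "\<bar>z\<bar> < 16"
      using abs_sin_cos_le[OF e1(2), of \<theta> \<phi>] abs_cos_le_one[of \<theta>] unfolding x_def z_def by linarith+
    have kX: "dX k = (\<lambda>i j. \<kappa> * dX c i j)" "dZ k = (\<lambda>i j. \<kappa> * dZ c i j)"
      "dX (\<lambda>i j. \<kappa> * dX c i j) = (\<lambda>i j. \<kappa> * dX (dX c) i j)"
      "dZ (\<lambda>i j. \<kappa> * dZ c i j) = (\<lambda>i j. \<kappa> * dZ (dZ c) i j)"
      "dZ (\<lambda>i j. \<kappa> * dX c i j) = (\<lambda>i j. \<kappa> * dZ (dX c) i j)"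
      by (intro ext; simp add: k_def dX_def dZ_def)+
    have "laplace_beltrami (in_coords \<Psi>) \<theta> \<phi> = \<kappa> * (e\<^sup>2 * series2 (dX (dX c)) x z + series2 (dZ (dZ c)) x z
     - (x\<^sup>2 * series2 (dX (dX c)) x z + 2 * x * z * series2 (dZ (dX c)) x z + z\<^sup>2 * series2 (dZ (dZ c)) x z
        + 2 * x * series2 (dX c) x z + 2 * z * series2 (dZ c) x z))"
      unfolding in\<Psi>
      by (subst laplace_beltrami_sph_series[OF gk _ e1(2) _ x_def z_def])
         (use sin_gt_zero[OF t] in \<open>auto simp: kX series2_cmult algebra_simps\<close>)
    also have "\<dots> = \<kappa> * ((dispersion e c - 6) * series2 c x z + e * series2 c x z ^ 3 + 4 * z)"
      by (subst series2_equation[OF cM b c(3)]) (rule refl)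
    finally have L: "laplace_beltrami (in_coords \<Psi>) \<theta> \<phi> = \<kappa> * ((dispersion e c - 6) * series2 c x z + e * series2 c x z ^ 3 + 4 * z)" .
    have F: "in_coords \<Psi> \<theta> \<phi> = \<kappa> * series2 c x z"
      unfolding in\<Psi> by (simp add: k_def series2_cmult x_def z_def)
    have "4 * \<gamma> * in_coords (sph_harm 1 0) \<theta> \<phi> = 4 * \<kappa> * z"
      unfolding in_coords_def sph_harm_1_0 by (simp add: \<kappa> z_def)
    then show "laplace_beltrami (in_coords \<Psi>) \<theta> \<phi> - 4 * \<gamma> * in_coords (sph_harm 1 0) \<theta> \<phi> =
        (dispersion e c - 6) * in_coords \<Psi> \<theta> \<phi> + e / \<kappa>\<^sup>2 * in_coords \<Psi> \<theta> \<phi> ^ 3"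
      unfolding L F using \<kappa>(2) by (simp add: power_mult_distrib power2_eq_square power3_eq_cube field_simps)
  qed
  moreover have "\<bar>sph_coeff (\<lambda>x. \<gamma> * sph_harm 1 0 x - \<Psi> x) n m\<bar> \<le> 128 * (\<bar>\<kappa>\<bar> * 2 ^ 60 * e) / 4 ^ n"
    if m: "\<bar>m\<bar> \<le> int n" for n m
  proof -
    define y where "y = (\<lambda>(i :: nat) (j :: nat). if (i, j) = (0, 1) then 1 else 0 :: real)"
    \<comment> \<open>The coefficients of the deviation from the base flow, with the scaling of
      \<open>x\<close> moved into them.\<close>
    define d where "d = (\<lambda>i j. \<kappa> * (y i j - c i j) * e ^ i)"
    have d: "\<bar>d i j\<bar> \<le> (\<bar>\<kappa>\<bar> * 2 ^ 60 * e) / 64 ^ (i + j)" for i j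
    proof -
      have g: "\<bar>c i j - base i j\<bar> * e ^ i \<le> e * 2 ^ 59 * (1 / 64 ^ (i + j)) * 1"
      proof (intro mult_mono power_le_one)
        have "e * 2 ^ 59 * wt i j \<le> e * 2 ^ 59 * (1 / 64 ^ (i + j))"
          using e by (intro mult_left_mono wt_le) auto
        then show "\<bar>c i j - base i j\<bar> \<le> e * 2 ^ 59 * (1 / 64 ^ (i + j))"
          using majorizedD[OF c(1), of i j] by linarith
      qed (use e e1 in auto)
      \<comment> \<open>The arrays differ only at the kernel index \<open>(1, 1)\<close>, where the
        entry 1 is made small by \<open>e ^ i = e\<close>.\<close>
      have y: "\<bar>y i j - base i j\<bar> * e ^ i \<le> e * 2 ^ 59 * (1 / 64 ^ (i + j))"
        using e by (auto simp: y_def base_def le_Suc_eq)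
      have "\<bar>y i j - c i j\<bar> \<le> \<bar>y i j - base i j\<bar> + \<bar>c i j - base i j\<bar>" by linarith
      then have "\<bar>y i j - c i j\<bar> * e ^ i \<le> (\<bar>y i j - base i j\<bar> + \<bar>c i j - base i j\<bar>) * e ^ i"
        using e by (intro mult_right_mono) auto
      also have "\<dots> \<le> e * 2 ^ 60 * (1 / 64 ^ (i + j))"
      proof -
        have "e * 2 ^ 60 * t = e * 2 ^ 59 * t + e * 2 ^ 59 * t * 1" for t :: real by simp
        then show ?thesis unfolding distrib_right using add_mono[OF y g] by (simp only:)
      qed
      finally have "\<bar>\<kappa>\<bar> * (\<bar>y i j - c i j\<bar> * e ^ i) \<le> \<bar>\<kappa>\<bar> * (e * 2 ^ 60 * (1 / 64 ^ (i + j)))"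
        by (rule mult_left_mono) simp
      then show ?thesis using e by (simp add: d_def abs_mult mult_ac)
    qed
    have "\<gamma> * sph_harm 1 0 (sph_pt \<theta> \<phi>) - \<Psi> (sph_pt \<theta> \<phi>) = sph_series 1 d \<theta> \<phi>" for \<theta> \<phi>
    proof (rule series2_eqI[symmetric])
      let ?x = "1 * (sin \<theta> * cos \<phi>)" and ?z = "cos \<theta>"
      have b: "\<bar>?x\<bar> \<le> 1" "\<bar>?z\<bar> \<le> 1" using abs_sin_cos_le[of 1 \<theta> \<phi>] by auto
      have b': "\<bar>e * ?x\<bar> \<le> 1" using abs_sin_cos_le[OF e1(2), of \<theta> \<phi>] by simp
      have "((\<lambda>(i, j). \<kappa> * y i j * e ^ i * ?x ^ i * ?z ^ j) has_sum \<kappa> * ?z) UNIV"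
        by (rule has_sum_finite_neutralI[of "{(0, 1)}"]) (auto simp: y_def split: if_splits)
      moreover have "((\<lambda>(i, j). k i j * (e * ?x) ^ i * ?z ^ j) has_sum sph_series e k \<theta> \<phi>) UNIV"
        using series2_has_sum[OF gk, of "e * ?x" ?z] b b' by simp
      ultimately have "((\<lambda>p. (case p of (i, j) \<Rightarrow> \<kappa> * y i j * e ^ i * ?x ^ i * ?z ^ j) + (- 1) * (case p of (i, j) \<Rightarrow> k i j * (e * ?x) ^ i * ?z ^ j))
          has_sum \<kappa> * ?z + (- 1) * sph_series e k \<theta> \<phi>) UNIV"
        by (intro has_sum_add has_sum_cmult_right)
      moreover have "\<kappa> * ?z + (- 1) * sph_series e k \<theta> \<phi> = \<gamma> * sph_harm 1 0 (sph_pt \<theta> \<phi>) - \<Psi> (sph_pt \<theta> \<phi>)"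
        unfolding sph_harm_1_0 \<Psi> by (simp add: \<kappa>)
      ultimately have "((\<lambda>p. (case p of (i, j) \<Rightarrow> \<kappa> * y i j * e ^ i * ?x ^ i * ?z ^ j) + (- 1) * (case p of (i, j) \<Rightarrow> k i j * (e * ?x) ^ i * ?z ^ j))
          has_sum \<gamma> * sph_harm 1 0 (sph_pt \<theta> \<phi>) - \<Psi> (sph_pt \<theta> \<phi>)) UNIV" by (simp only:)
      then show "((\<lambda>(i, j). d i j * ?x ^ i * ?z ^ j) has_sum \<gamma> * sph_harm 1 0 (sph_pt \<theta> \<phi>) - \<Psi> (sph_pt \<theta> \<phi>)) UNIV"
        by (rule iffD1[OF has_sum_cong, rotated]) (auto simp: d_def k_def power_mult_distrib algebra_simps)
    qed
    from sph_coeff_bound[OF d m this] show ?thesis .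
  qed
  ultimately show ?thesis by blast
qed

theorem corollary1p3:
  fixes \<gamma> :: real
  assumes "\<gamma> \<noteq> 0"
  shows "\<exists>l>0. \<exists>\<epsilon>0>0. \<exists>\<Psi> :: real \<Rightarrow> real^3 \<Rightarrow> real.
    (\<forall>\<epsilon>. 0 < \<epsilon> \<and> \<epsilon> \<le> \<epsilon>0 \<longrightarrow>
       analytic_on_sphere (\<Psi> \<epsilon>) \<and> \<not> zonal (\<Psi> \<epsilon>) \<and> nontrivial (\<Psi> \<epsilon>) \<and>
       steady_euler \<gamma> (\<Psi> \<epsilon>) \<and>
       gevrey_finite l (\<lambda>x. \<gamma> * sph_harm 1 0 x - \<Psi> \<epsilon> x)) \<and>
    (\<lambda>\<epsilon>. gevrey_norm l (\<lambda>x. \<gamma> * sph_harm 1 0 x - \<Psi> \<epsilon> x)) \<in> O[at_right 0](\<lambda>\<epsilon>. \<epsilon>)"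
proof -
  define \<kappa> where "\<kappa> = \<gamma> / 2 * sqrt (3 / pi)"
  have "\<kappa> \<noteq> 0" using assms by (simp add: \<kappa>_def)
  define good where "good = (\<lambda>\<epsilon> \<Psi>. analytic_on_sphere \<Psi> \<and> nontrivial \<Psi> \<and> steady_euler \<gamma> \<Psi> \<and>
    (\<forall>n m. \<bar>m\<bar> \<le> int n \<longrightarrow>
       \<bar>sph_coeff (\<lambda>x. \<gamma> * sph_harm 1 0 x - \<Psi> x) n m\<bar> \<le> (128 * (\<bar>\<kappa>\<bar> * 2 ^ 60 * \<epsilon>)) / 4 ^ n))"
  have "\<exists>\<Psi>. good \<epsilon> \<Psi>" if \<epsilon>: "0 < \<epsilon> \<and> \<epsilon> \<le> 1 / 2 ^ 60" for \<epsilon>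
    unfolding good_def
    by (rule steady_solution_exists[OF \<kappa>_def \<open>\<kappa> \<noteq> 0\<close> conjunct1[OF \<epsilon>] conjunct2[OF \<epsilon>]])
  \<comment> \<open>One solution is chosen for each admissible parameter; the arbitrary values
    elsewhere do not affect the estimate at \<open>at_right 0\<close>.\<close>
  then obtain \<Psi> where \<Psi>: "\<And>\<epsilon>. 0 < \<epsilon> \<and> \<epsilon> \<le> 1 / 2 ^ 60 \<Longrightarrow> good \<epsilon> (\<Psi> \<epsilon>)" by metis
  define C where "C = 51 * (128 * (\<bar>\<kappa>\<bar> * 2 ^ 60))"
  have G: "gevrey_finite (1 / 4) (\<lambda>x. \<gamma> * sph_harm 1 0 x - \<Psi> \<epsilon> x)"
    "norm (gevrey_norm (1 / 4) (\<lambda>x. \<gamma> * sph_harm 1 0 x - \<Psi> \<epsilon> x)) \<le> C * norm \<epsilon>" if "0 < \<epsilon> \<and> \<epsilon> \<le> 1 / 2 ^ 60" for \<epsilon>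
    using gevrey_norm_bound[of "128 * (\<bar>\<kappa>\<bar> * 2 ^ 60 * \<epsilon>)" "\<lambda>x. \<gamma> * sph_harm 1 0 x - \<Psi> \<epsilon> x"] \<Psi>[OF that] that
    unfolding good_def by (auto simp: C_def mult_ac)
  have "\<forall>\<^sub>F \<epsilon> in at_right 0. 0 < \<epsilon> \<and> \<epsilon> \<le> 1 / (2 :: real) ^ 60"
    unfolding eventually_at_right_field by (rule exI[of _ "1 / 2 ^ 60"]) auto
  then have "\<forall>\<^sub>F \<epsilon> in at_right 0. norm (gevrey_norm (1 / 4) (\<lambda>x. \<gamma> * sph_harm 1 0 x - \<Psi> \<epsilon> x)) \<le> C * norm \<epsilon>"
    by eventually_elim (rule G(2))
  then have "(\<lambda>\<epsilon>. gevrey_norm (1 / 4) (\<lambda>x. \<gamma> * sph_harm 1 0 x - \<Psi> \<epsilon> x)) \<in> O[at_right 0](\<lambda>\<epsilon>. \<epsilon>)"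
    by (rule bigoI)
  then show ?thesis
    using \<Psi> G(1) nontrivial_imp_not_zonal unfolding good_def
    by (intro exI[of _ "1 / 4"] exI[of _ "1 / 2 ^ 60"] exI[of _ \<Psi>] conjI allI impI) auto
qed

end
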